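(* Let $(E,\rho_E,[\cdot,\cdot]_E,J_E,g)$ be a Kählerian transitive Lie algebroid over a smooth manifold $M$ with $\mathrm{rank}\,E=2m\geq 4$. If the holomorphic sectional curvature depends only on $x\in M$ (it is independent of the $J_E$-invariant $2$-plane $P$, that is, for every $x\in M$ the number $K(P)$ is the same for all $J_E$-invariant $2$-planes $P\subset E_x$), then $(E,\rho_E,[\cdot,\cdot]_E,J_E,g)$ is of constant holomorphic sectional curvature.
   Context: A Lie algebroid $(E,\rho_E,[\cdot,\cdot]_E)$ over a smooth manifold $M$ is a real vector bundle $E\to M$ with a vector bundle morphism $\rho_E:E\to TM$ (the anchor) and a real Lie algebra bracket $[\cdot,\cdot]_E$ on $\Gamma(E)$ such that $\rho_E([s_1,s_2]_E)=[\rho_E(s_1),\rho_E(s_2)]$ and $[s_1,fs_2]_E=f[s_1,s_2]_E+\rho_E(s_1)(f)s_2$ for all $s_1,s_2\in\Gamma(E)$, $f\in C^\infty(M)$. It is transitive if $\rho_E$ is surjective. An almost complex structure on $E$ ($\mathrm{rank}\,E=2m$) is an endomorphism $J_E$ of $E$ over the identity with $J_E^2=-\mathrm{id}$; it is integrable if $N_{J_E}(s_1,s_2)=[J_Es_1,J_Es_2]_E-J_E[s_1,J_Es_2]_E-J_E[J_Es_1,s_2]_E-[s_1,s_2]_E$ vanishes for all $s_1,s_2\in\Gamma(E)$. A Hermitian metric is a Riemannian (fibrewise positive definite) metric $g$ on $E$ with $g(J_Es_1,J_Es_2)=g(s_1,s_2)$; its fundamental $2$-form is $\Phi(s_1,s_2)=g(s_1,J_Es_2)$.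 The Lie algebroid differential of a $2$-form is $$d_E\Phi(s_0,s_1,s_2)=\sum_{i=0}^2(-1)^i\rho_E(s_i)\big(\Phi(s_0,\ldots,\widehat{s_i},\ldots,s_2)\big)+\sum_{i<j}(-1)^{i+j}\Phi([s_i,s_j]_E,\ldots,\widehat{s_i},\ldots,\widehat{s_j},\ldots).$$ $(E,\rho_E,[\cdot,\cdot]_E,J_E,g)$ is Kählerian if $J_E$ is integrable and $d_E\Phi=0$. A linear connection on $E$ is an $\mathbb R$-bilinear map $\nabla:\Gamma(E)\times\Gamma(E)\to\Gamma(E)$ with $\nabla_{fs_1}s_2=f\nabla_{s_1}s_2$ and $\nabla_{s_1}(fs_2)=(\rho_E(s_1)f)s_2+f\nabla_{s_1}s_2$. The Levi-Civita connection $D$ of $g$ is the unique linear connection on $E$ with $\rho_E(s)(g(s_1,s_2))=g(D_ss_1,s_2)+g(s_1,D_ss_2)$ and $D_{s_1}s_2-D_{s_2}s_1=[s_1,s_2]_E$. Its curvature is $R(s_1,s_2)s_3=D_{s_1}D_{s_2}s_3-D_{s_2}D_{s_1}s_3-D_{[s_1,s_2]_E}s_3$, and $\mathcal R(s_1,s_2,s_3,s_4)=g(R(s_3,s_4)s_2,s_1)$. For $x\in M$ and a $2$-plane $P\subset E_x$ that is $J_E$-invariant ($J_E(P)\subset P$) with basis $\{s_1,s_2\}$, put $$K(P)=\frac{\mathcal R(s_1,s_2,s_1,s_2)}{g(s_1,s_1)g(s_2,s_2)-g(s_1,s_2)^2}.$$ The function $K$ restricted to $J_E$-invariant $2$-planes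 is the holomorphic sectional curvature. The Kählerian Lie algebroid is said to be of constant holomorphic sectional curvature if the function $K$ is constant for all $J_E$-invariant $2$-planes of $E_x$ and for every $x\in M$.
   Formalization: The manifold M is assumed connected; without this the claim fails, e.g. for the tangent bundle of the disjoint union of CP^2 (Fubini–Study metric) and flat C^2, where K depends only on x but takes two different values. *)

theory Defs
  imports "HOL-Analysis.Analysis"
begin

section \<open>Smooth functions and manifolds\<close>

text \<open>Used for open \<open>S\<close> in a finite-dimensional domain, where asking for iterated directional
  derivatives to be differentiable and continuous is the usual \<open>C\<^sup>k\<close> condition.\<close>

primrec Ck_on :: "nat \<Rightarrow> 'a::real_normed_vector set \<Rightarrow> ('a \<Rightarrow> 'c::real_normed_vector) \<Rightarrow> bool" where
  "Ck_on 0 S f \<longleftrightarrow> continuous_on S f"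
| "Ck_on (Suc k) S f \<longleftrightarrow>
     (\<forall>x\<in>S. f differentiable (at x)) \<and> (\<forall>v. Ck_on k S (\<lambda>x. frechet_derivative f (at x) v))"

definition smooth_on :: "'a::real_normed_vector set \<Rightarrow> ('a \<Rightarrow> 'c::real_normed_vector) \<Rightarrow> bool" where
  "smooth_on S f \<longleftrightarrow> (\<forall>k. Ck_on k S f)"

text \<open>The manifold \<open>M\<close> is the whole (Hausdorff, second countable) type \<open>'p\<close>. Charts take values in a
  finite-dimensional inner product space \<open>'b\<close>; the class \<open>euclidean_space\<close> is avoided only because it
  would exclude manifolds of dimension \<open>0\<close>. A chart is a pair of its domain and its coordinate map,
  which is total in HOL but only meaningful on the domain. The atlas need not be maximal.\<close>

locale smooth_manifold =
  fixes charts :: "('p::{t2_space,second_countable_topology} set \<times> ('p \<Rightarrow> 'b::real_inner)) set"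
  assumes finite_dim: "\<exists>B::'b set. finite B \<and> span B = UNIV"
    and charts_cover: "(\<Union>(U,\<phi>)\<in>charts. U) = UNIV"
    and chart_open: "\<And>U \<phi>. (U,\<phi>) \<in> charts \<Longrightarrow> open U \<and> open (\<phi> ` U)"
    and chart_homeomorphism:
      "\<And>U \<phi>. (U,\<phi>) \<in> charts \<Longrightarrow> homeomorphism U (\<phi> ` U) \<phi> (inv_into U \<phi>)"
    and charts_compatible:
      "\<And>U \<phi> V \<psi>. (U,\<phi>) \<in> charts \<Longrightarrow> (V,\<psi>) \<in> charts \<Longrightarrow>
         smooth_on (\<phi> ` (U \<inter> V)) (\<lambda>y. \<psi> (inv_into U \<phi> y))"
begin

definition smooth_fun_on :: "'p set \<Rightarrow> ('p \<Rightarrow> 'c::real_normed_vector) \<Rightarrow> bool" where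
  "smooth_fun_on W f \<longleftrightarrow>
     (\<forall>(U,\<phi>)\<in>charts. smooth_on (\<phi> ` (U \<inter> W)) (\<lambda>y. f (inv_into U \<phi> y)))"

definition C_inf :: "('p \<Rightarrow> real) set" where
  "C_inf = {f. smooth_fun_on UNIV f}"

text \<open>Tangent vectors are the derivations of \<open>C\<^sup>\<infinity>(M)\<close> at \<open>x\<close>, normalised to vanish on non-smooth
  functions so that equal derivations are equal as HOL functions.\<close>

definition tangent_space :: "'p \<Rightarrow> (('p \<Rightarrow> real) \<Rightarrow> real) set" where
  "tangent_space x = {v.
     (\<forall>f. f \<notin> C_inf \<longrightarrow> v f = 0) \<and>
     (\<forall>f\<in>C_inf. \<forall>h\<in>C_inf. v (\<lambda>y. f y + h y) = v f + v h) \<and>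
     (\<forall>c. \<forall>f\<in>C_inf. v (\<lambda>y. c * f y) = c * v f) \<and>
     (\<forall>f\<in>C_inf. \<forall>h\<in>C_inf. v (\<lambda>y. f y * h y) = f x * v h + h x * v f)}"

end


section \<open>Vector bundles\<close>

definition fibre_linear :: "'v::real_vector set \<Rightarrow> ('v \<Rightarrow> 'w::real_vector) \<Rightarrow> bool" where
  "fibre_linear V L \<longleftrightarrow>
     (\<forall>u\<in>V. \<forall>w\<in>V. L (u + w) = L u + L w) \<and> (\<forall>c. \<forall>u\<in>V. L (c *\<^sub>R u) = c *\<^sub>R L u)"

text \<open>The fibres \<open>E x\<close> are linear subspaces of one real vector space \<open>'v\<close>, which carries no topology
  and may have any dimension; every family of vector spaces is of this form (take the direct sum of
  the fibres). The typical fibre is \<open>'f\<close>, so the rank is \<open>DIM('f)\<close>. A local trivialisation is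
  given by its inverse: \<open>(U, \<sigma>)\<close> stands for the isomorphisms \<open>\<sigma> x\<close> from \<open>'f\<close> onto \<open>E x\<close>,
  \<open>x \<in> U\<close>. The smooth structure of the total space is the one determined by the trivialisations.\<close>

locale vector_bundle = smooth_manifold charts
  for charts :: "('p::{t2_space,second_countable_topology} set \<times> ('p \<Rightarrow> 'b::real_inner)) set" +
  fixes E :: "'p \<Rightarrow> 'v::real_vector set"
    and trivs :: "('p set \<times> ('p \<Rightarrow> 'f::euclidean_space \<Rightarrow> 'v)) set"
  assumes trivs_cover: "(\<Union>(U,\<sigma>)\<in>trivs. U) = UNIV"
    and triv_open: "\<And>U \<sigma>. (U,\<sigma>) \<in> trivs \<Longrightarrow> open U"
    and triv_iso:
      "\<And>U \<sigma> x. (U,\<sigma>) \<in> trivs \<Longrightarrow> x \<in> U \<Longrightarrow> linear (\<sigma> x) \<and> inj (\<sigma> x) \<and> range (\<sigma> x) = E x"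
    and trivs_compatible:
      "\<And>U \<sigma> V \<tau> a. (U,\<sigma>) \<in> trivs \<Longrightarrow> (V,\<tau>) \<in> trivs \<Longrightarrow>
         smooth_fun_on (U \<inter> V) (\<lambda>x. inv (\<tau> x) (\<sigma> x a))"
begin

definition \<Gamma> :: "('p \<Rightarrow> 'v) set" where
  "\<Gamma> = {s. (\<forall>x. s x \<in> E x) \<and> (\<forall>(U,\<sigma>)\<in>trivs. smooth_fun_on U (\<lambda>x. inv (\<sigma> x) (s x)))}"

end


section \<open>Lie algebroids\<close>

text \<open>\<open>rho x e f\<close> is the derivative of \<open>f\<close> along the anchor \<open>\<rho>\<^sub>E(e) \<in> T\<^sub>xM\<close> of \<open>e \<in> E x\<close>.
  \<open>anchor_smooth\<close> says that the anchor is a smooth bundle morphism: it maps each local frame of \<open>E\<close>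
  to smooth local vector fields, and a local vector field is smooth iff it maps \<open>C\<^sup>\<infinity>(M)\<close> to smooth
  functions. The bracket is only meaningful on \<open>\<Gamma>\<close>.\<close>

locale lie_algebroid = vector_bundle charts E trivs
  for charts :: "('p::{t2_space,second_countable_topology} set \<times> ('p \<Rightarrow> 'b::real_inner)) set"
    and E :: "'p \<Rightarrow> 'v::real_vector set"
    and trivs :: "('p set \<times> ('p \<Rightarrow> 'f::euclidean_space \<Rightarrow> 'v)) set" +
  fixes rho :: "'p \<Rightarrow> 'v \<Rightarrow> ('p \<Rightarrow> real) \<Rightarrow> real"
    and br :: "('p \<Rightarrow> 'v) \<Rightarrow> ('p \<Rightarrow> 'v) \<Rightarrow> ('p \<Rightarrow> 'v)"
  assumes anchor_tangent: "\<And>x e. e \<in> E x \<Longrightarrow> rho x e \<in> tangent_space x"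
    and anchor_linear: "\<And>x f. fibre_linear (E x) (\<lambda>e. rho x e f)"
    and anchor_smooth:
      "\<And>U \<sigma> a f. (U,\<sigma>) \<in> trivs \<Longrightarrow> f \<in> C_inf \<Longrightarrow> smooth_fun_on U (\<lambda>x. rho x (\<sigma> x a) f)"
    and br_closed: "\<And>s t. s \<in> \<Gamma> \<Longrightarrow> t \<in> \<Gamma> \<Longrightarrow> br s t \<in> \<Gamma>"
    and br_add_left:
      "\<And>s t u. s \<in> \<Gamma> \<Longrightarrow> t \<in> \<Gamma> \<Longrightarrow> u \<in> \<Gamma> \<Longrightarrow> br (\<lambda>x. s x + t x) u = (\<lambda>x. br s u x + br t u x)"
    and br_scale_left:
      "\<And>c s t. s \<in> \<Gamma> \<Longrightarrow> t \<in> \<Gamma> \<Longrightarrow> br (\<lambda>x. c *\<^sub>R s x) t = (\<lambda>x. c *\<^sub>R br s t x)"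
    and br_skew: "\<And>s t. s \<in> \<Gamma> \<Longrightarrow> t \<in> \<Gamma> \<Longrightarrow> br s t = (\<lambda>x. - br t s x)"
    and br_jacobi:
      "\<And>s t u. s \<in> \<Gamma> \<Longrightarrow> t \<in> \<Gamma> \<Longrightarrow> u \<in> \<Gamma> \<Longrightarrow>
         (\<lambda>x. br s (br t u) x + br t (br u s) x + br u (br s t) x) = (\<lambda>x. 0)"
    and anchor_br:
      "\<And>s t f x. s \<in> \<Gamma> \<Longrightarrow> t \<in> \<Gamma> \<Longrightarrow> f \<in> C_inf \<Longrightarrow>
         rho x (br s t x) f =
           rho x (s x) (\<lambda>y. rho y (t y) f) - rho x (t x) (\<lambda>y. rho y (s y) f)"
    and br_leibniz:
      "\<And>s t f. s \<in> \<Gamma> \<Longrightarrow> t \<in> \<Gamma> \<Longrightarrow> f \<in> C_inf \<Longrightarrow>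
         br s (\<lambda>x. f x *\<^sub>R t x) = (\<lambda>x. f x *\<^sub>R br s t x + rho x (s x) f *\<^sub>R t x)"
begin

text \<open>The differential of a \<open>2\<close>-form, given by its values on sections.\<close>

definition d\<^sub>E :: "(('p \<Rightarrow> 'v) \<Rightarrow> ('p \<Rightarrow> 'v) \<Rightarrow> 'p \<Rightarrow> real)
    \<Rightarrow> ('p \<Rightarrow> 'v) \<Rightarrow> ('p \<Rightarrow> 'v) \<Rightarrow> ('p \<Rightarrow> 'v) \<Rightarrow> 'p \<Rightarrow> real" where
  "d\<^sub>E \<omega> s0 s1 s2 x =
     rho x (s0 x) (\<omega> s1 s2) - rho x (s1 x) (\<omega> s0 s2) + rho x (s2 x) (\<omega> s0 s1)
     - \<omega> (br s0 s1) s2 x + \<omega> (br s0 s2) s1 x - \<omega> (br s1 s2) s0 x"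

definition linear_connection :: "(('p \<Rightarrow> 'v) \<Rightarrow> ('p \<Rightarrow> 'v) \<Rightarrow> ('p \<Rightarrow> 'v)) \<Rightarrow> bool" where
  "linear_connection D \<longleftrightarrow>
     (\<forall>s\<in>\<Gamma>. \<forall>t\<in>\<Gamma>. D s t \<in> \<Gamma>) \<and>
     (\<forall>s\<in>\<Gamma>. \<forall>t\<in>\<Gamma>. \<forall>u\<in>\<Gamma>. D (\<lambda>x. s x + t x) u = (\<lambda>x. D s u x + D t u x)) \<and>
     (\<forall>s\<in>\<Gamma>. \<forall>t\<in>\<Gamma>. \<forall>u\<in>\<Gamma>. D s (\<lambda>x. t x + u x) = (\<lambda>x. D s t x + D s u x)) \<and>
     (\<forall>c. \<forall>s\<in>\<Gamma>. \<forall>t\<in>\<Gamma>. D (\<lambda>x. c *\<^sub>R s x) t = (\<lambda>x. c *\<^sub>R D s t x)) \<and>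
     (\<forall>c. \<forall>s\<in>\<Gamma>. \<forall>t\<in>\<Gamma>. D s (\<lambda>x. c *\<^sub>R t x) = (\<lambda>x. c *\<^sub>R D s t x)) \<and>
     (\<forall>f\<in>C_inf. \<forall>s\<in>\<Gamma>. \<forall>t\<in>\<Gamma>. D (\<lambda>x. f x *\<^sub>R s x) t = (\<lambda>x. f x *\<^sub>R D s t x)) \<and>
     (\<forall>f\<in>C_inf. \<forall>s\<in>\<Gamma>. \<forall>t\<in>\<Gamma>.
        D s (\<lambda>x. f x *\<^sub>R t x) = (\<lambda>x. rho x (s x) f *\<^sub>R t x + f x *\<^sub>R D s t x))"

definition curvature :: "(('p \<Rightarrow> 'v) \<Rightarrow> ('p \<Rightarrow> 'v) \<Rightarrow> ('p \<Rightarrow> 'v))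
    \<Rightarrow> ('p \<Rightarrow> 'v) \<Rightarrow> ('p \<Rightarrow> 'v) \<Rightarrow> ('p \<Rightarrow> 'v) \<Rightarrow> 'p \<Rightarrow> 'v" where
  "curvature D s1 s2 s3 x = D s1 (D s2 s3) x - D s2 (D s1 s3) x - D (br s1 s2) s3 x"

end

locale transitive_lie_algebroid = lie_algebroid +
  assumes anchor_surj: "\<And>x. rho x ` E x = tangent_space x"


section \<open>Hermitian and Kaehlerian Lie algebroids\<close>

locale hermitian_lie_algebroid = lie_algebroid charts E trivs rho br
  for charts :: "('p::{t2_space,second_countable_topology} set \<times> ('p \<Rightarrow> 'b::real_inner)) set"
    and E :: "'p \<Rightarrow> 'v::real_vector set"
    and trivs :: "('p set \<times> ('p \<Rightarrow> 'f::euclidean_space \<Rightarrow> 'v)) set"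
    and rho :: "'p \<Rightarrow> 'v \<Rightarrow> ('p \<Rightarrow> real) \<Rightarrow> real"
    and br :: "('p \<Rightarrow> 'v) \<Rightarrow> ('p \<Rightarrow> 'v) \<Rightarrow> ('p \<Rightarrow> 'v)" +
  fixes J :: "'p \<Rightarrow> 'v \<Rightarrow> 'v"
    and g :: "'p \<Rightarrow> 'v \<Rightarrow> 'v \<Rightarrow> real"
  assumes J_closed: "\<And>x e. e \<in> E x \<Longrightarrow> J x e \<in> E x"
    and J_linear: "\<And>x. fibre_linear (E x) (J x)"
    and J_smooth: "\<And>U \<sigma> a. (U,\<sigma>) \<in> trivs \<Longrightarrow> smooth_fun_on U (\<lambda>x. inv (\<sigma> x) (J x (\<sigma> x a)))"
    and J_squared: "\<And>x e. e \<in> E x \<Longrightarrow> J x (J x e) = - e"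
    and g_linear: "\<And>x e. e \<in> E x \<Longrightarrow> fibre_linear (E x) (g x e)"
    and g_sym: "\<And>x e e'. e \<in> E x \<Longrightarrow> e' \<in> E x \<Longrightarrow> g x e e' = g x e' e"
    and g_pos: "\<And>x e. e \<in> E x \<Longrightarrow> e \<noteq> 0 \<Longrightarrow> g x e e > 0"
    and g_smooth: "\<And>U \<sigma> a b. (U,\<sigma>) \<in> trivs \<Longrightarrow> smooth_fun_on U (\<lambda>x. g x (\<sigma> x a) (\<sigma> x b))"
    and g_hermitian: "\<And>x e e'. e \<in> E x \<Longrightarrow> e' \<in> E x \<Longrightarrow> g x (J x e) (J x e') = g x e e'"
begin

definition Js :: "('p \<Rightarrow> 'v) \<Rightarrow> ('p \<Rightarrow> 'v)" where
  "Js s = (\<lambda>x. J x (s x))"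

definition nijenhuis :: "('p \<Rightarrow> 'v) \<Rightarrow> ('p \<Rightarrow> 'v) \<Rightarrow> 'p \<Rightarrow> 'v" where
  "nijenhuis s t x = br (Js s) (Js t) x - Js (br s (Js t)) x - Js (br (Js s) t) x - br s t x"

definition \<Phi> :: "('p \<Rightarrow> 'v) \<Rightarrow> ('p \<Rightarrow> 'v) \<Rightarrow> 'p \<Rightarrow> real" where
  "\<Phi> s t x = g x (s x) (J x (t x))"

definition levi_civita :: "(('p \<Rightarrow> 'v) \<Rightarrow> ('p \<Rightarrow> 'v) \<Rightarrow> ('p \<Rightarrow> 'v)) \<Rightarrow> bool" where
  "levi_civita D \<longleftrightarrow> linear_connection D \<and>
     (\<forall>s\<in>\<Gamma>. \<forall>s1\<in>\<Gamma>. \<forall>s2\<in>\<Gamma>. \<forall>x.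
        rho x (s x) (\<lambda>y. g y (s1 y) (s2 y)) = g x (D s s1 x) (s2 x) + g x (s1 x) (D s s2 x)) \<and>
     (\<forall>s1\<in>\<Gamma>. \<forall>s2\<in>\<Gamma>. (\<lambda>x. D s1 s2 x - D s2 s1 x) = br s1 s2)"

definition riem :: "(('p \<Rightarrow> 'v) \<Rightarrow> ('p \<Rightarrow> 'v) \<Rightarrow> ('p \<Rightarrow> 'v))
    \<Rightarrow> ('p \<Rightarrow> 'v) \<Rightarrow> ('p \<Rightarrow> 'v) \<Rightarrow> ('p \<Rightarrow> 'v) \<Rightarrow> ('p \<Rightarrow> 'v) \<Rightarrow> 'p \<Rightarrow> real" where
  "riem D s1 s2 s3 s4 x = g x (curvature D s3 s4 s2 x) (s1 x)"

text \<open>The curvature is evaluated on sections \<open>s1\<close>, \<open>s2\<close> whose values at \<open>x\<close> form a basis of \<open>P\<close>. The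
  Levi-Civita connection is unique on \<open>\<Gamma>\<close> and the quotient depends neither on the basis nor on
  the sections extending it, so the description below is a proper one.\<close>

definition sectional_curvature :: "'p \<Rightarrow> 'v set \<Rightarrow> real" where
  "sectional_curvature x P = (THE k. \<exists>D s1 s2.
     levi_civita D \<and> s1 \<in> \<Gamma> \<and> s2 \<in> \<Gamma> \<and>
     s1 x \<noteq> s2 x \<and> independent {s1 x, s2 x} \<and> span {s1 x, s2 x} = P \<and>
     k = riem D s1 s2 s1 s2 x /
         (g x (s1 x) (s1 x) * g x (s2 x) (s2 x) - (g x (s1 x) (s2 x))\<^sup>2))"

definition holomorphic_planes :: "'p \<Rightarrow> 'v set set" where
  "holomorphic_planes x = {P. subspace P \<and> dim P = 2 \<and> P \<subseteq> E x \<and> J x ` P \<subseteq> P}"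

definition hol_curvature_pointwise_constant :: bool where
  "hol_curvature_pointwise_constant \<longleftrightarrow>
     (\<forall>x. \<exists>c. \<forall>P\<in>holomorphic_planes x. sectional_curvature x P = c)"

definition constant_hol_curvature :: bool where
  "constant_hol_curvature \<longleftrightarrow>
     (\<exists>c. \<forall>x. \<forall>P\<in>holomorphic_planes x. sectional_curvature x P = c)"

end

locale kaehlerian_lie_algebroid = hermitian_lie_algebroid +
  assumes J_integrable: "\<And>s t. s \<in> \<Gamma> \<Longrightarrow> t \<in> \<Gamma> \<Longrightarrow> nijenhuis s t = (\<lambda>x. 0)"
    and \<Phi>_closed: "\<And>s0 s1 s2. s0 \<in> \<Gamma> \<Longrightarrow> s1 \<in> \<Gamma> \<Longrightarrow> s2 \<in> \<Gamma> \<Longrightarrow> d\<^sub>E \<Phi> s0 s1 s2 = (\<lambda>x. 0)"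

end

theory Submission
  imports Defs "HOL-Library.Function_Algebras"
begin

text \<open>
  This is Schur's argument, carried out with global sections instead of tangent vectors. Fix a
  Levi-Civita connection \<open>D\<close>, write \<open>Q X Y Z W = g(R(X,Y)Z, W)\<close>, and let \<open>c x\<close> be the common value of
  the holomorphic sectional curvatures at \<open>x\<close>, so that \<open>Q(Y,JY,JY,Y) = c |Y|\<^sup>4\<close> for every section \<open>Y\<close>.

  On a Kaehlerian Lie algebroid \<open>J\<close> is parallel (\<open>J_parallel\<close>), hence \<open>Q\<close> has the symmetries of a
  Kaehler curvature tensor, and so does its covariant derivative \<open>DQ U\<close> in any direction \<open>U\<close>. For a
  form \<open>T\<close> with these symmetries the first-order polarisation of \<open>T(Y,JY,JY,Y) = k |Y|\<^sup>4\<close> at a point is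
  \<open>T(Y,JY,JY,X) = k |Y|\<^sup>2 g(Y,X)\<close> (\<open>kaehler_form_polarise\<close>). Applied to \<open>Q\<close> it gives
  \<open>DQ U(Y,JY,JY,Y) = (U c) |Y|\<^sup>4\<close>, and applied to \<open>DQ U\<close> with \<open>k = U c\<close> it determines the terms of the
  second Bianchi identity for the directions \<open>X\<close>, \<open>Y\<close>, \<open>JY\<close>, paired with \<open>JY\<close> and \<open>Y\<close>. If \<open>Y\<close> is
  orthogonal to \<open>X\<close> and \<open>JX\<close> at the point, which rank at least \<open>3\<close> permits with \<open>Y\<close> nonzero there,
  two of the three terms vanish and what remains is \<open>(X c) |Y|\<^sup>4 = 0\<close> (\<open>schur_orthogonal\<close>). The
  explicit form of the full curvature tensor is never needed.

  Transitivity turns this into the vanishing of all derivations on the smooth function \<open>c\<close>, so \<open>c\<close>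
  is constant on the connected manifold (\<open>smooth_constant_if_derivations_vanish\<close>).

  Two facts link sections with their values. Smooth bump functions extend every vector of a fibre
  to a global section, and they show that a map on sections that is linear over the smooth functions,
  evaluated at \<open>x\<close>, depends only on the value at \<open>x\<close> (\<open>tensorial_pointwise\<close>). Together with the uniqueness
  of the Levi-Civita connection this makes the sectional curvature of a plane computable from any
  sections spanning it (\<open>sectional_curvature_eq\<close>). Existence of the Levi-Civita connection is not
  needed: without one, the definite description of the sectional curvature has the same body
  \<open>False\<close> for all planes.
\<close>

section \<open>Calculus of smooth functions\<close>

lemma Ck_on_subset: "Ck_on k S f \<Longrightarrow> T \<subseteq> S \<Longrightarrow> Ck_on k T f"
  by (induction k arbitrary: f) (auto intro: continuous_on_subset)

text \<open>Openness matters here: \<^const>\<open>frechet_derivative\<close> at a point sees a full neighbourhood.\<close>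

lemma Ck_on_cong:
  assumes "open S" "Ck_on k S f" "\<And>x. x \<in> S \<Longrightarrow> f x = h x"
  shows "Ck_on k S h"
  using assms(2,3)
proof (induction k arbitrary: f h)
  case 0
  then show ?case by (simp cong: continuous_on_cong)
next
  case (Suc k)
  have D: "(h has_derivative frechet_derivative f (at x)) (at x)" if "x \<in> S" for x
    using Suc.prems that assms(1)
    by (intro has_derivative_transform_within_open[of f _ x UNIV S h]) (auto simp: frechet_derivative_works)
  then have "frechet_derivative h (at x) = frechet_derivative f (at x)" if "x \<in> S" for x
    using frechet_derivative_at[OF D[OF that]] by simp
  then show ?case
    using Suc.prems(1) D by (auto simp: differentiable_def intro: Suc.IH)
qed

lemma Ck_on_SucD:
  "Ck_on (Suc k) S f \<Longrightarrow> x \<in> S \<Longrightarrow> (f has_derivative frechet_derivative f (at x)) (at x)"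
  by (auto simp: frechet_derivative_works)

lemma Ck_on_SucI:
  assumes "open S" "\<And>x. x \<in> S \<Longrightarrow> (f has_derivative f' x) (at x)" "\<And>v. Ck_on k S (\<lambda>x. f' x v)"
  shows "Ck_on (Suc k) S f"
proof -
  have "Ck_on k S (\<lambda>x. frechet_derivative f (at x) v)" for v
    using frechet_derivative_at[OF assms(2)] by (intro Ck_on_cong[OF assms(1) assms(3)[of v]]) metis
  then show ?thesis
    using assms(2) by (auto simp: differentiable_def)
qed

lemma Ck_on_Suc: "Ck_on (Suc k) S f \<Longrightarrow> Ck_on k S f"
proof (induction k arbitrary: f)
  case 0
  then show ?case
    by (auto intro!: continuous_at_imp_continuous_on differentiable_imp_continuous_within)
next
  case (Suc k)
  then have "Ck_on k S (\<lambda>x. frechet_derivative f (at x) v)" for v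
    by auto
  with Suc.prems show ?case by auto
qed

lemma Ck_on_local:
  assumes "\<And>x. x \<in> S \<Longrightarrow> \<exists>T. open T \<and> x \<in> T \<and> Ck_on k (S \<inter> T) f" and "open S"
  shows "Ck_on k S f"
  using assms(1)
proof (induction k arbitrary: f)
  case 0
  have "isCont f x" if x: "x \<in> S" for x
  proof -
    obtain T where "open T" "x \<in> T" "continuous_on (S \<inter> T) f"
      using 0[OF x] by auto
    then show ?thesis
      using x assms(2) continuous_on_eq_continuous_at[of "S \<inter> T" f] by auto
  qed
  then show ?case by (simp add: continuous_at_imp_continuous_on)
next
  case (Suc k)
  have "f differentiable (at x)" if "x \<in> S" for x
    using Suc.prems[OF that] that by auto
  moreover have "Ck_on k S (\<lambda>x. frechet_derivative f (at x) v)" for v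
    using Suc.prems by (intro Suc.IH) fastforce
  ultimately show ?case by auto
qed

lemma Ck_on_const: "open S \<Longrightarrow> Ck_on k S (\<lambda>x. c)"
  by (induction k arbitrary: c) (auto intro!: continuous_on_const Ck_on_SucI[where f' = "\<lambda>_ _. 0"] simp del: Ck_on.simps(2))

lemma Ck_on_add:
  "open S \<Longrightarrow> Ck_on k S f \<Longrightarrow> Ck_on k S h \<Longrightarrow> Ck_on k S (\<lambda>x. f x + h x)"
proof (induction k arbitrary: f h)
  case 0
  then show ?case by (auto intro: continuous_on_add)
next
  case (Suc k)
  show ?case
  proof (rule Ck_on_SucI[OF Suc.prems(1)])
    show "((\<lambda>x. f x + h x) has_derivative (\<lambda>v. frechet_derivative f (at x) v + frechet_derivative h (at x) v)) (at x)"
      if "x \<in> S" for x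
      using that Suc.prems by (intro has_derivative_add Ck_on_SucD)
    show "Ck_on k S (\<lambda>x. frechet_derivative f (at x) v + frechet_derivative h (at x) v)" for v
      using Suc by auto
  qed
qed

lemma Ck_on_bilinear:
  assumes "bounded_bilinear B" "open S"
  shows "Ck_on k S f \<Longrightarrow> Ck_on k S h \<Longrightarrow> Ck_on k S (\<lambda>x. B (f x) (h x))"
proof (induction k arbitrary: f h)
  case 0
  then show ?case by (auto intro: bounded_bilinear.continuous_on[OF assms(1)])
next
  case (Suc k)
  show ?case
  proof (rule Ck_on_SucI[OF assms(2)])
    show "((\<lambda>x. B (f x) (h x)) has_derivative
        (\<lambda>v. B (f x) (frechet_derivative h (at x) v) + B (frechet_derivative f (at x) v) (h x))) (at x)"
      if "x \<in> S" for x
      using that Suc.prems by (intro bounded_bilinear.FDERIV[OF assms(1)] Ck_on_SucD)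
    show "Ck_on k S (\<lambda>x. B (f x) (frechet_derivative h (at x) v) + B (frechet_derivative f (at x) v) (h x))" for v
      using Suc.prems by (intro Ck_on_add Suc.IH assms(2)) (auto intro: Ck_on_Suc[OF Suc.prems(1)] Ck_on_Suc[OF Suc.prems(2)])
  qed
qed

lemma Ck_on_linear:
  assumes "bounded_linear L" "open S"
  shows "Ck_on k S f \<Longrightarrow> Ck_on k S (\<lambda>x. L (f x))"
proof (induction k arbitrary: f)
  case 0
  then show ?case by (auto intro: bounded_linear.continuous_on[OF assms(1)])
next
  case (Suc k)
  show ?case
  proof (rule Ck_on_SucI[OF assms(2)])
    show "((\<lambda>x. L (f x)) has_derivative (\<lambda>v. L (frechet_derivative f (at x) v))) (at x)"
      if "x \<in> S" for x
      using that Suc.prems by (intro bounded_linear.has_derivative[OF assms(1)] Ck_on_SucD)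
    show "Ck_on k S (\<lambda>x. L (frechet_derivative f (at x) v))" for v
      using Suc by auto
  qed
qed

text \<open>Composition is only needed with an outer function of one real variable, where the outer
  derivative in the chain rule is a number.\<close>

lemma Ck_on_compose_real:
  fixes h :: "real \<Rightarrow> real"
  assumes "open S"
  shows "Ck_on k UNIV h \<Longrightarrow> Ck_on k S q \<Longrightarrow> Ck_on k S (\<lambda>x. h (q x))"
proof (induction k arbitrary: h q)
  case 0
  then show ?case by (auto intro: continuous_on_compose2)
next
  case (Suc k)
  define h' where "h' t = frechet_derivative h (at t) 1" for t
  have h': "(h has_derivative (\<lambda>v. v * h' t)) (at t)" for t
  proof -
    have *: "(h has_derivative frechet_derivative h (at t)) (at t)"
      using Ck_on_SucD[OF Suc.prems(1)] by auto
    then have "frechet_derivative h (at t) v = v * h' t" for v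
      using linear_cmul[OF has_derivative_linear[OF *], of v 1] by (simp add: h'_def)
    then have "frechet_derivative h (at t) = (\<lambda>v. v * h' t)" by (rule ext)
    with * show ?thesis by simp
  qed
  show ?case
  proof (rule Ck_on_SucI[OF assms])
    show "((\<lambda>x. h (q x)) has_derivative (\<lambda>v. frechet_derivative q (at x) v * h' (q x))) (at x)"
      if "x \<in> S" for x
      using has_derivative_compose[OF Ck_on_SucD[OF Suc.prems(2) that] h'] .
    have "Ck_on k UNIV h'" "Ck_on k S (\<lambda>x. frechet_derivative q (at x) v)" for v
      using Suc.prems by (auto simp: h'_def[abs_def])
    then show "Ck_on k S (\<lambda>x. frechet_derivative q (at x) v * h' (q x))" for v
      using Suc.IH Ck_on_Suc[OF Suc.prems(2)]
      by (intro Ck_on_bilinear[OF bounded_bilinear_mult assms]) auto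
  qed
qed

lemma Ck_on_inverse:
  fixes q :: "'a::real_normed_vector \<Rightarrow> real"
  assumes "open S" "\<And>x. x \<in> S \<Longrightarrow> q x \<noteq> 0"
  shows "Ck_on k S q \<Longrightarrow> Ck_on k S (\<lambda>x. inverse (q x))"
proof (induction k)
  case 0
  then show ?case using assms by (auto intro: continuous_on_inverse)
next
  case (Suc k)
  show ?case
  proof (rule Ck_on_SucI[OF assms(1)])
    show "((\<lambda>x. inverse (q x)) has_derivative
        (\<lambda>v. - (inverse (q x) * frechet_derivative q (at x) v * inverse (q x)))) (at x)"
      if "x \<in> S" for x
      using that assms Suc.prems by (intro Deriv.has_derivative_inverse Ck_on_SucD) auto
    have "Ck_on k S (\<lambda>x. frechet_derivative q (at x) v)" for v
      using Suc.prems by simp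
    then show "Ck_on k S (\<lambda>x. - (inverse (q x) * frechet_derivative q (at x) v * inverse (q x)))" for v
      using Suc.IH[OF Ck_on_Suc[OF Suc.prems]]
      by (intro Ck_on_linear[OF bounded_linear_minus[OF bounded_linear_ident]]
          Ck_on_bilinear[OF bounded_bilinear_mult] assms(1))
  qed
qed

text \<open>The function \<open>exp(-1/t) t\<^sup>-\<^sup>n\<close> on the positive reals, extended by \<open>0\<close>. The exponent \<open>n\<close> makes the
  derivative of each member a linear combination of members, so all of them are smooth; \<open>n = 0\<close> is the
  function from which bump functions are made.\<close>

definition flat_exp :: "nat \<Rightarrow> real \<Rightarrow> real" where
  "flat_exp n t = (if t > 0 then exp (- inverse t) * inverse t ^ n else 0)"

lemma flat_exp_tendsto_0: "(flat_exp n \<longlongrightarrow> 0) (at 0)"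
proof -
  have "((\<lambda>t. inverse t ^ n / exp (inverse t)) \<longlongrightarrow> (0::real)) (at_right 0)"
    using filterlim_compose[OF tendsto_power_div_exp_0 filterlim_inverse_at_top_right] .
  then have "(flat_exp n \<longlongrightarrow> 0) (at_right 0)"
    by (rule Lim_transform_eventually)
      (auto simp: eventually_at_right_field flat_exp_def exp_minus field_simps intro!: exI[of _ 1])
  moreover have "(flat_exp n \<longlongrightarrow> 0) (at_left 0)"
    by (rule Lim_transform_eventually[of "\<lambda>_. 0"])
      (auto simp: eventually_at_left_field flat_exp_def intro!: exI[of _ "-1"])
  ultimately show ?thesis
    by (simp add: filterlim_at_split)
qed

lemma flat_exp_deriv:
  "(flat_exp n has_real_derivative flat_exp (n + 2) t - n * flat_exp (n + 1) t) (at t)"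
proof -
  consider "t > 0" | "t < 0" | "t = 0" by linarith
  then show ?thesis
  proof cases
    case 1
    have "((\<lambda>t. exp (- inverse t) * inverse t ^ n) has_real_derivative
        flat_exp (n + 2) t - n * flat_exp (n + 1) t) (at t)"
      using 1
      by (auto intro!: derivative_eq_intros; cases n; simp add: flat_exp_def field_simps power2_eq_square)
    then show ?thesis
      by (rule has_field_derivative_transform_within_open[of _ _ _ "{0<..}"])
        (use 1 in \<open>auto simp: flat_exp_def\<close>)
  next
    case 2
    have "((\<lambda>t. 0) has_real_derivative flat_exp (n + 2) t - n * flat_exp (n + 1) t) (at t)"
      using 2 by (auto simp: flat_exp_def)
    then show ?thesis
      by (rule has_field_derivative_transform_within_open[of _ _ _ "{..<0}"])
        (use 2 in \<open>auto simp: flat_exp_def\<close>)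
  next
    case 3
    have "((\<lambda>h. flat_exp n h / h) \<longlongrightarrow> 0) (at 0)"
      by (rule Lim_transform_eventually[OF flat_exp_tendsto_0[of "Suc n"]])
        (auto simp: flat_exp_def eventually_at_filter field_simps intro!: always_eventually)
    then show ?thesis
      using 3 by (simp add: DERIV_def flat_exp_def)
  qed
qed

lemma flat_exp_smooth: "Ck_on k UNIV (flat_exp n)"
proof (induction k arbitrary: n)
  case 0
  then show ?case
    using DERIV_isCont[OF flat_exp_deriv] by (auto intro: continuous_at_imp_continuous_on)
next
  case (Suc k)
  show ?case
  proof (rule Ck_on_SucI)
    show "(flat_exp n has_derivative (\<lambda>v. flat_exp (n + 2) t * v + flat_exp (n + 1) t * (- real n * v))) (at t)" for t
      using flat_exp_deriv[of n t] unfolding has_field_derivative_def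
      by (rule has_derivative_eq_rhs) (auto simp: algebra_simps)
    show "Ck_on k UNIV (\<lambda>t. flat_exp (n + 2) t * v + flat_exp (n + 1) t * (- real n * v))" for v
      by (intro Ck_on_add Ck_on_bilinear[OF bounded_bilinear_mult] Ck_on_const Suc open_UNIV)
  qed auto
qed

text \<open>A ball is a closed part of a compact box spanned by an orthogonal basis. The Heine-Borel class
  is avoided because the chart space is only an inner product space with a finite spanning set.\<close>

lemma compact_cball_finite_span:
  fixes a :: "'b::real_inner"
  assumes "finite B" "span B = (UNIV :: 'b set)"
  shows "compact (cball a r)"
proof -
  obtain C0 :: "'b set" where C0: "finite C0" "span C0 = span B" "pairwise orthogonal C0"
    using basis_orthogonal[OF assms(1)] by blast
  \<comment> \<open>An orthogonal set may contain \<open>0\<close>, which has to go before dividing by norms.\<close>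
  define C where "C = C0 - {0}"
  have C: "finite C" "span C = UNIV" "pairwise orthogonal C" "0 \<notin> C"
    using C0 assms(2) span_delete_0[of C0] by (auto simp: C_def pairwise_def)
  have box: "compact {\<Sum>c\<in>F. t c *\<^sub>R c |t. \<forall>c\<in>F. \<bar>t c\<bar> \<le> R}" if "finite F" for F :: "'b set" and R
    using that
  proof induction
    case empty
    then show ?case by simp
  next
    case (insert d F)
    have "compact ((\<lambda>s. s *\<^sub>R d) ` {-R..R})"
      by (intro compact_continuous_image continuous_intros) auto
    moreover have "{\<Sum>c\<in>insert d F. t c *\<^sub>R c |t. \<forall>c\<in>insert d F. \<bar>t c\<bar> \<le> R} =
        {x + y |x y. x \<in> (\<lambda>s. s *\<^sub>R d) ` {-R..R} \<and> y \<in> {\<Sum>c\<in>F. t c *\<^sub>R c |t. \<forall>c\<in>F. \<bar>t c\<bar> \<le> R}}"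
      (is "?L = ?R")
    proof
      show "?L \<subseteq> ?R"
        using insert.hyps by (fastforce simp: abs_le_iff)
      show "?R \<subseteq> ?L"
      proof clarify
        fix s t assume s: "s \<in> {-R..R}" and t: "\<forall>c\<in>F. \<bar>t c\<bar> \<le> R"
        have "(\<Sum>c\<in>F. (t(d := s)) c *\<^sub>R c) = (\<Sum>c\<in>F. t c *\<^sub>R c)"
          using insert.hyps by (intro sum.cong) auto
        then show "\<exists>t'. s *\<^sub>R d + (\<Sum>c\<in>F. t c *\<^sub>R c) = (\<Sum>c\<in>insert d F. t' c *\<^sub>R c)
            \<and> (\<forall>c\<in>insert d F. \<bar>t' c\<bar> \<le> R)"
          using insert.hyps s t by (intro exI[of _ "t(d := s)"]) auto
      qed
    qed
    ultimately show ?case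
      using compact_sums[OF _ insert.IH] by simp
  qed
  define R where "R = (\<Sum>c\<in>C. (norm a + \<bar>r\<bar>) / norm c)"
  have "cball a r \<subseteq> {\<Sum>c\<in>C. t c *\<^sub>R c |t. \<forall>c\<in>C. \<bar>t c\<bar> \<le> R}"
  proof
    fix x assume x: "x \<in> cball a r"
    have nx: "norm x \<le> norm a + \<bar>r\<bar>"
      using x norm_triangle_ineq2[of x a] by (simp add: dist_norm norm_minus_commute[of a])
    obtain t where t: "x = (\<Sum>c\<in>C. t c *\<^sub>R c)"
      using C(2) span_finite[OF C(1)] by blast
    have "\<bar>t d\<bar> \<le> R" if d: "d \<in> C" for d
    proof -
      have "x \<bullet> d = (\<Sum>c\<in>C. if c = d then t d * (d \<bullet> d) else 0)"
        unfolding t inner_sum_left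
        using C(3) d by (intro sum.cong) (auto simp: pairwise_def orthogonal_def)
      then have "x \<bullet> d = t d * (norm d)\<^sup>2"
        using C(1) d by (simp add: dot_square_norm)
      then have "(\<bar>t d\<bar> * norm d) * norm d \<le> norm x * norm d"
        using Cauchy_Schwarz_ineq2[of x d] by (simp add: abs_mult power2_eq_square mult.assoc)
      then have "\<bar>t d\<bar> \<le> norm x / norm d"
        using C(4) d by (cases "d = 0") (auto simp: pos_le_divide_eq mult.assoc)
      also have "\<dots> \<le> (norm a + \<bar>r\<bar>) / norm d"
        using nx by (simp add: divide_right_mono)
      also have "\<dots> \<le> R"
        unfolding R_def using C(1) d by (intro member_le_sum) auto
      finally show ?thesis .
    qed
    then show "x \<in> {\<Sum>c\<in>C. t c *\<^sub>R c |t. \<forall>c\<in>C. \<bar>t c\<bar> \<le> R}"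
      using t by blast
  qed
  with compact_Int_closed[OF box[OF C(1), of R] closed_cball[of a r]] show ?thesis
    by (simp add: Int_absorb1)
qed


section \<open>Smooth functions on a manifold\<close>

context smooth_manifold
begin

lemma chart_at: obtains U \<phi> where "(U,\<phi>) \<in> charts" "x \<in> U"
proof -
  have "x \<in> (\<Union>(U,\<phi>)\<in>charts. U)" by (simp add: charts_cover)
  then show thesis using that by auto
qed

lemma chart_inv:
  assumes "(U,\<phi>) \<in> charts"
  shows "x \<in> U \<Longrightarrow> inv_into U \<phi> (\<phi> x) = x" "y \<in> \<phi> ` (U \<inter> W) \<Longrightarrow> inv_into U \<phi> y \<in> U \<inter> W"
  using homeomorphism_apply1[OF chart_homeomorphism[OF assms]] by auto

lemma chart_image_open:
  assumes "(U,\<phi>) \<in> charts" "open W"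
  shows "open (\<phi> ` (U \<inter> W))"
proof -
  have "\<phi> ` (U \<inter> W) = \<phi> ` U \<inter> inv_into U \<phi> -` W"
    using chart_inv(1)[OF assms(1)] by force
  moreover have "continuous_on (\<phi> ` U) (inv_into U \<phi>)"
    using chart_homeomorphism[OF assms(1)] by (simp add: homeomorphism_def)
  ultimately show ?thesis
    using continuous_open_preimage chart_open[OF assms(1)] assms(2) by metis
qed

lemma smooth_fun_onI:
  assumes "\<And>U \<phi> k. (U,\<phi>) \<in> charts \<Longrightarrow> Ck_on k (\<phi> ` (U \<inter> W)) (\<lambda>y. f (inv_into U \<phi> y))"
  shows "smooth_fun_on W f"
  using assms by (auto simp: smooth_fun_on_def smooth_on_def)

lemma smooth_fun_onD:
  assumes "smooth_fun_on W f" "(U,\<phi>) \<in> charts"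
  shows "Ck_on k (\<phi> ` (U \<inter> W)) (\<lambda>y. f (inv_into U \<phi> y))"
  using assms by (auto simp: smooth_fun_on_def smooth_on_def)

lemma smooth_fun_on_subset: "smooth_fun_on W f \<Longrightarrow> V \<subseteq> W \<Longrightarrow> smooth_fun_on V f"
  by (rule smooth_fun_onI, erule Ck_on_subset[OF smooth_fun_onD]) auto

lemma smooth_fun_on_cong:
  assumes "open W" "smooth_fun_on W f" "\<And>x. x \<in> W \<Longrightarrow> f x = h x"
  shows "smooth_fun_on W h"
proof (rule smooth_fun_onI)
  fix U \<phi> k assume c: "(U,\<phi>) \<in> charts"
  show "Ck_on k (\<phi> ` (U \<inter> W)) (\<lambda>y. h (inv_into U \<phi> y))"
    using chart_inv(2)[OF c] assms(3)
    by (intro Ck_on_cong[OF chart_image_open[OF c assms(1)] smooth_fun_onD[OF assms(2) c]]) blast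
qed

lemma smooth_fun_on_local:
  assumes "open W" "\<And>x. x \<in> W \<Longrightarrow> \<exists>V. open V \<and> x \<in> V \<and> smooth_fun_on (W \<inter> V) f"
  shows "smooth_fun_on W f"
proof (rule smooth_fun_onI)
  fix U \<phi> k assume c: "(U,\<phi>) \<in> charts"
  show "Ck_on k (\<phi> ` (U \<inter> W)) (\<lambda>y. f (inv_into U \<phi> y))"
  proof (rule Ck_on_local[OF _ chart_image_open[OF c assms(1)]])
    fix y assume "y \<in> \<phi> ` (U \<inter> W)"
    then obtain x where x: "x \<in> U" "x \<in> W" "y = \<phi> x" by blast
    obtain V where V: "open V" "x \<in> V" "smooth_fun_on (W \<inter> V) f"
      using assms(2)[OF x(2)] by blast
    have "\<phi> ` (U \<inter> W) \<inter> \<phi> ` (U \<inter> V) \<subseteq> \<phi> ` (U \<inter> (W \<inter> V))"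
      using chart_inv(1)[OF c] by (auto intro!: imageI) (metis IntI imageI)
    then have "Ck_on k (\<phi> ` (U \<inter> W) \<inter> \<phi> ` (U \<inter> V)) (\<lambda>y. f (inv_into U \<phi> y))"
      by (rule Ck_on_subset[OF smooth_fun_onD[OF V(3) c]])
    then show "\<exists>T. open T \<and> y \<in> T \<and> Ck_on k (\<phi> ` (U \<inter> W) \<inter> T) (\<lambda>y. f (inv_into U \<phi> y))"
      using x V chart_image_open[OF c V(1)] by blast
  qed
qed

lemma smooth_fun_on_const: "open W \<Longrightarrow> smooth_fun_on W (\<lambda>x. c)"
  by (rule smooth_fun_onI) (intro Ck_on_const chart_image_open)

lemma smooth_fun_on_add:
  "open W \<Longrightarrow> smooth_fun_on W f \<Longrightarrow> smooth_fun_on W h \<Longrightarrow> smooth_fun_on W (\<lambda>x. f x + h x)"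
  by (rule smooth_fun_onI) (intro Ck_on_add chart_image_open smooth_fun_onD)

lemma smooth_fun_on_sum:
  "open W \<Longrightarrow> (\<And>i. i \<in> I \<Longrightarrow> smooth_fun_on W (f i)) \<Longrightarrow> smooth_fun_on W (\<lambda>x. \<Sum>i\<in>I. f i x)"
  by (induction I rule: infinite_finite_induct) (auto intro: smooth_fun_on_const smooth_fun_on_add)

lemma smooth_fun_on_bilinear:
  assumes "bounded_bilinear B" "open W" "smooth_fun_on W f" "smooth_fun_on W h"
  shows "smooth_fun_on W (\<lambda>x. B (f x) (h x))"
  by (rule smooth_fun_onI) (intro Ck_on_bilinear[OF assms(1)] chart_image_open smooth_fun_onD assms)

lemmas smooth_fun_on_mult = smooth_fun_on_bilinear[OF bounded_bilinear_mult]
lemmas smooth_fun_on_scaleR = smooth_fun_on_bilinear[OF bounded_bilinear_scaleR]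
lemmas smooth_fun_on_inner = smooth_fun_on_bilinear[OF bounded_bilinear_inner]

lemma smooth_fun_on_inverse:
  fixes f :: "'p \<Rightarrow> real"
  assumes "open W" "smooth_fun_on W f" "\<And>x. x \<in> W \<Longrightarrow> f x \<noteq> 0"
  shows "smooth_fun_on W (\<lambda>x. inverse (f x))"
proof (rule smooth_fun_onI)
  fix U \<phi> k assume c: "(U,\<phi>) \<in> charts"
  show "Ck_on k (\<phi> ` (U \<inter> W)) (\<lambda>y. inverse (f (inv_into U \<phi> y)))"
    using chart_inv(2)[OF c] assms(3)
    by (intro Ck_on_inverse[OF chart_image_open[OF c assms(1)] _ smooth_fun_onD[OF assms(2) c]]) blast
qed

lemma smooth_fun_on_compose_real:
  fixes h :: "real \<Rightarrow> real"
  assumes "\<And>k. Ck_on k UNIV h" "open W" "smooth_fun_on W f"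
  shows "smooth_fun_on W (\<lambda>x. h (f x))"
  by (rule smooth_fun_onI)
    (rule Ck_on_compose_real[OF chart_image_open[OF _ assms(2)] assms(1) smooth_fun_onD[OF assms(3)]])

lemma smooth_chart: "(U,\<phi>) \<in> charts \<Longrightarrow> smooth_fun_on U \<phi>"
  using charts_compatible by (auto simp: smooth_fun_on_def)

text \<open>The support \<open>K\<close> is the preimage of a closed ball in a chart. It is closed in the manifold
  because it is compact and the manifold is Hausdorff; this is what makes the extension by \<open>0\<close>
  smooth.\<close>

lemma bump_function:
  assumes "open W" "x \<in> W"
  obtains f K where "f \<in> C_inf" "f x = 1" "closed K" "K \<subseteq> W" "\<And>y. y \<notin> K \<Longrightarrow> f y = 0"
proof -
  obtain U \<phi> where c: "(U,\<phi>) \<in> charts" "x \<in> U"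
    by (rule chart_at)
  have U: "open U" and hom: "homeomorphism U (\<phi> ` U) \<phi> (inv_into U \<phi>)"
    using chart_open chart_homeomorphism c by blast+
  have "open (\<phi> ` (U \<inter> W))" "\<phi> x \<in> \<phi> ` (U \<inter> W)"
    using chart_image_open c assms by blast+
  then obtain r where r: "r > 0" "cball (\<phi> x) r \<subseteq> \<phi> ` (U \<inter> W)"
    using open_contains_cball by metis
  define K where "K = inv_into U \<phi> ` cball (\<phi> x) r"
  have "continuous_on (cball (\<phi> x) r) (inv_into U \<phi>)"
    using hom r(2) by (auto simp: homeomorphism_def intro: continuous_on_subset)
  moreover have "compact (cball (\<phi> x) r)"
    using finite_dim compact_cball_finite_span by blast
  ultimately have K: "closed K"
    unfolding K_def using compact_continuous_image compact_imp_closed by blast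
  have KW: "K \<subseteq> U \<inter> W"
    unfolding K_def using r(2) chart_inv(2)[OF c(1)] by blast
  define f where "f y = (if y \<in> U then flat_exp 0 (r\<^sup>2 - (\<phi> y - \<phi> x) \<bullet> (\<phi> y - \<phi> x)) else 0)" for y
  have f0: "f y = 0" if "y \<notin> K" for y
  proof (cases "y \<in> U")
    case True
    have "\<phi> y \<notin> cball (\<phi> x) r"
    proof
      assume "\<phi> y \<in> cball (\<phi> x) r"
      then have "inv_into U \<phi> (\<phi> y) \<in> K"
        unfolding K_def by (rule imageI)
      then show False
        using chart_inv(1)[OF c(1) True] that by simp
    qed
    then have "r < norm (\<phi> y - \<phi> x)"
      by (simp add: dist_norm norm_minus_commute)
    then have "r\<^sup>2 < (norm (\<phi> y - \<phi> x))\<^sup>2"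
      using r(1) by (intro power_strict_mono) auto
    then show ?thesis
      by (simp add: f_def flat_exp_def dot_square_norm)
  qed (simp add: f_def)
  have sub: "smooth_fun_on U (\<lambda>y. \<phi> y - \<phi> x)"
    using smooth_fun_on_add[OF U smooth_chart[OF c(1)] smooth_fun_on_const[OF U, of "- \<phi> x"]] by simp
  have "smooth_fun_on U (\<lambda>y. r\<^sup>2 + (-1) * ((\<phi> y - \<phi> x) \<bullet> (\<phi> y - \<phi> x)))"
    by (intro smooth_fun_on_add[OF U] smooth_fun_on_mult[OF U] smooth_fun_on_inner[OF U] smooth_fun_on_const U sub)
  then have "smooth_fun_on U (\<lambda>y. flat_exp 0 (r\<^sup>2 + (-1) * ((\<phi> y - \<phi> x) \<bullet> (\<phi> y - \<phi> x))))"
    by (intro smooth_fun_on_compose_real[OF flat_exp_smooth U])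
  then have fU: "smooth_fun_on U f"
    by (rule smooth_fun_on_cong[OF U]) (simp add: f_def)
  have fK: "smooth_fun_on (- K) f"
    by (rule smooth_fun_on_cong[OF _ smooth_fun_on_const[of _ 0]]) (use K f0 in auto)
  have "smooth_fun_on UNIV f"
  proof (rule smooth_fun_on_local)
    fix y show "\<exists>V. open V \<and> y \<in> V \<and> smooth_fun_on (UNIV \<inter> V) f"
      using fU fK U K KW by (cases "y \<in> K") auto
  qed simp
  then have "smooth_fun_on UNIV (\<lambda>y. inverse (f x) * f y)"
    by (intro smooth_fun_on_mult smooth_fun_on_const) auto
  moreover have "f x > 0"
    using c(2) r(1) by (simp add: f_def flat_exp_def)
  ultimately show thesis
    using K KW f0 by (intro that[of "\<lambda>y. inverse (f x) * f y" K]) (auto simp: C_inf_def)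
qed

lemma smooth_fun_on_cutoff:
  assumes "f \<in> C_inf" "closed K" "K \<subseteq> W" "\<And>y. y \<notin> K \<Longrightarrow> f y = 0"
    and "open W" "open V" "smooth_fun_on (W \<inter> V) a"
  shows "smooth_fun_on V (\<lambda>y. f y *\<^sub>R a y)"
proof (rule smooth_fun_on_local[OF assms(6)])
  have "smooth_fun_on (W \<inter> V) (\<lambda>y. f y *\<^sub>R a y)"
    using assms by (intro smooth_fun_on_scaleR) (auto simp: C_inf_def intro: smooth_fun_on_subset)
  then have 1: "smooth_fun_on (V \<inter> W) (\<lambda>y. f y *\<^sub>R a y)"
    by (simp add: Int_commute)
  have 2: "smooth_fun_on (V \<inter> - K) (\<lambda>y. f y *\<^sub>R a y)"
    by (rule smooth_fun_on_cong[OF _ smooth_fun_on_const[of _ 0]]) (use assms in auto)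
  fix x assume "x \<in> V"
  then show "\<exists>U. open U \<and> x \<in> U \<and> smooth_fun_on (V \<inter> U) (\<lambda>y. f y *\<^sub>R a y)"
    using 1 2 assms by (cases "x \<in> K") auto
qed

lemma C_inf_const: "(\<lambda>x. c) \<in> C_inf"
  by (simp add: C_inf_def smooth_fun_on_const)

lemma C_inf_add: "f \<in> C_inf \<Longrightarrow> h \<in> C_inf \<Longrightarrow> f + h \<in> C_inf"
  by (simp add: C_inf_def plus_fun_def smooth_fun_on_add)

lemma C_inf_mult: "f \<in> C_inf \<Longrightarrow> h \<in> C_inf \<Longrightarrow> f * h \<in> C_inf"
  by (simp add: C_inf_def times_fun_def smooth_fun_on_mult)

lemma C_inf_minus: "f \<in> C_inf \<Longrightarrow> - f \<in> C_inf"
  using C_inf_mult[OF C_inf_const[of "-1"], of f] by (simp add: times_fun_def fun_Compl_def)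

lemma C_inf_diff: "f \<in> C_inf \<Longrightarrow> h \<in> C_inf \<Longrightarrow> f - h \<in> C_inf"
  using C_inf_add[OF _ C_inf_minus] by fastforce

lemmas C_inf_closed = C_inf_const C_inf_add C_inf_mult C_inf_minus C_inf_diff

lemma open_nonzero_set:
  assumes "f \<in> C_inf" shows "open {x. f x \<noteq> 0}"
proof (subst open_subopen, intro ballI)
  fix x assume x: "x \<in> {x. f x \<noteq> 0}"
  obtain U \<phi> where c: "(U,\<phi>) \<in> charts" "x \<in> U" by (rule chart_at)
  have "Ck_on 0 (\<phi> ` (U \<inter> UNIV)) (\<lambda>y. f (inv_into U \<phi> y))"
    using assms by (intro smooth_fun_onD c) (simp add: C_inf_def)
  moreover have "continuous_on U \<phi>"
    using chart_homeomorphism[OF c(1)] by (simp add: homeomorphism_def)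
  ultimately have "continuous_on U (\<lambda>y. f (inv_into U \<phi> (\<phi> y)))"
    by (auto intro: continuous_on_compose2)
  then have "continuous_on U f"
    using chart_inv(1)[OF c(1)] by (simp cong: continuous_on_cong)
  then have "open (U \<inter> f -` (- {0}))"
    using chart_open[OF c(1)] by (intro continuous_open_preimage) auto
  then show "\<exists>T. open T \<and> x \<in> T \<and> T \<subseteq> {x. f x \<noteq> 0}"
    using x c(2) by (intro exI[of _ "U \<inter> f -` (- {0})"]) auto
qed

text \<open>The directional derivatives in a chart are derivations, so they annihilate \<open>f\<close>.\<close>

lemma smooth_constant_if_derivations_vanish:
  assumes "connected (UNIV :: 'p set)" "f \<in> C_inf" "\<And>x v. v \<in> tangent_space x \<Longrightarrow> v f = 0"
  shows "f x = f y"
proof (rule connected_local_const[OF assms(1)])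
  show "\<forall>a\<in>UNIV. \<forall>\<^sub>F b in at a within UNIV. f a = f b"
  proof
    fix a :: 'p
    obtain U \<phi> where c: "(U,\<phi>) \<in> charts" "a \<in> U"
      by (rule chart_at)
    let ?h = "\<lambda>h y. h (inv_into U \<phi> y)"
    have diff: "(?h h has_derivative frechet_derivative (?h h) (at (\<phi> p))) (at (\<phi> p))"
      if "h \<in> C_inf" "p \<in> U" for h :: "'p \<Rightarrow> real" and p
    proof -
      have "Ck_on (Suc 0) (\<phi> ` (U \<inter> UNIV)) (?h h)"
        using that(1) by (intro smooth_fun_onD c) (simp add: C_inf_def)
      then show ?thesis
        by (rule Ck_on_SucD) (use that(2) in simp)
    qed
    have zero: "frechet_derivative (?h f) (at (\<phi> p)) w = 0" if p: "p \<in> U" for p w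
    proof -
      define v where "v h = (if h \<in> C_inf then frechet_derivative (?h h) (at (\<phi> p)) w else 0)" for h
      have inv: "inv_into U \<phi> (\<phi> p) = p"
        using chart_inv(1)[OF c(1) p] .
      have "v (\<lambda>y. h y + k y) = v h + v k" if "h \<in> C_inf" "k \<in> C_inf" for h k
        using frechet_derivative_at[OF has_derivative_add[OF diff[OF that(1) p] diff[OF that(2) p]]]
          C_inf_add[OF that] that by (simp add: v_def plus_fun_def) (metis)
      moreover have "v (\<lambda>y. c * h y) = c * v h" if "h \<in> C_inf" for h c
        using frechet_derivative_at[OF has_derivative_mult_right[OF diff[OF that p], of c]]
          C_inf_mult[OF C_inf_const[of c] that] that by (simp add: v_def times_fun_def) (metis)
      moreover have "v (\<lambda>y. h y * k y) = h p * v k + k p * v h" if "h \<in> C_inf" "k \<in> C_inf" for h k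
        using fun_cong[OF frechet_derivative_at[OF has_derivative_mult[OF diff[OF that(1) p] diff[OF that(2) p]]], of w]
          C_inf_mult[OF that] that by (simp add: v_def times_fun_def inv mult.commute)
      ultimately have "v \<in> tangent_space p"
        by (auto simp: tangent_space_def v_def)
      then have "v f = 0" by (rule assms(3))
      then show ?thesis using assms(2) by (simp add: v_def)
    qed
    have "open (\<phi> ` U)" using chart_open c by blast
    then obtain r where r: "r > 0" "ball (\<phi> a) r \<subseteq> \<phi> ` U"
      using c(2) open_contains_ball by blast
    have "\<exists>k. \<forall>y\<in>ball (\<phi> a) r. ?h f y = k"
    proof (rule has_derivative_zero_constant[OF convex_ball])
      fix y assume y: "y \<in> ball (\<phi> a) r"
      then obtain p where p: "p \<in> U" "y = \<phi> p" using r(2) by blast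
      show "(?h f has_derivative (\<lambda>h. 0)) (at y within ball (\<phi> a) r)"
        unfolding p(2) by (rule has_derivative_eq_rhs[OF has_derivative_at_withinI[OF diff[OF assms(2) p(1)]]])
          (use zero[OF p(1)] in \<open>simp add: fun_eq_iff\<close>)
    qed
    then obtain k where k: "\<And>y. y \<in> ball (\<phi> a) r \<Longrightarrow> ?h f y = k" by blast
    define N where "N = U \<inter> \<phi> -` ball (\<phi> a) r"
    have "continuous_on U \<phi>"
      using chart_homeomorphism[OF c(1)] by (simp add: homeomorphism_def)
    then have "open N"
      unfolding N_def using chart_open[OF c(1)] by (intro continuous_open_preimage) auto
    moreover have "a \<in> N"
      using c r(1) by (simp add: N_def)
    moreover have "f b = k" if "b \<in> N" for b
      using k[of "\<phi> b"] that chart_inv(1)[OF c(1), of b] by (simp add: N_def)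
    ultimately show "\<forall>\<^sub>F b in at a within UNIV. f a = f b"
      unfolding eventually_at_topological by metis
  qed
qed auto

end


section \<open>Sections of a vector bundle\<close>

context vector_bundle
begin

lemma triv_at: obtains U \<sigma> where "(U,\<sigma>) \<in> trivs" "x \<in> U"
proof -
  have "x \<in> (\<Union>(U,\<sigma>)\<in>trivs. U)" by (simp add: trivs_cover)
  then show thesis using that by auto
qed

lemma triv_linear:
  assumes "(U,\<sigma>) \<in> trivs" "x \<in> U"
  shows "linear (\<sigma> x)" "inj (\<sigma> x)" "range (\<sigma> x) = E x" "\<sigma> x a \<in> E x" "inv (\<sigma> x) (\<sigma> x a) = a"
    "e \<in> E x \<Longrightarrow> \<sigma> x (inv (\<sigma> x) e) = e" "fibre_linear (E x) (inv (\<sigma> x))"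
proof -
  show *: "linear (\<sigma> x)" "inj (\<sigma> x)" "range (\<sigma> x) = E x"
    using triv_iso[OF assms] by auto
  show "\<sigma> x a \<in> E x" "inv (\<sigma> x) (\<sigma> x a) = a"  "e \<in> E x \<Longrightarrow> \<sigma> x (inv (\<sigma> x) e) = e"
    using *(2,3) by (auto simp: f_inv_into_f)
  show "fibre_linear (E x) (inv (\<sigma> x))"
    unfolding fibre_linear_def *(3)[symmetric]
    using *(2) by (auto simp: linear_add[OF *(1), symmetric] linear_cmul[OF *(1), symmetric])
qed

lemma subspace_fibre: "subspace (E x)"
  by (metis triv_at triv_linear(1,3) linear_subspace_image subspace_UNIV)

lemma fibre_linear_sum:
  assumes "fibre_linear (E x) L" "\<And>i. i \<in> I \<Longrightarrow> u i \<in> E x"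
  shows "L (\<Sum>i\<in>I. c i *\<^sub>R u i) = (\<Sum>i\<in>I. c i *\<^sub>R L (u i))"
proof -
  have L0: "L 0 = 0"
    using assms(1) subspace_0[OF subspace_fibre[of x]] unfolding fibre_linear_def
    by (metis scaleR_zero_left)
  show ?thesis
    using assms(2)
  proof (induction I rule: infinite_finite_induct)
    case (insert i I)
    moreover have "(\<Sum>i\<in>I. c i *\<^sub>R u i) \<in> E x"
      using insert by (intro subspace_sum subspace_scale subspace_fibre) auto
    ultimately show ?case
      using assms(1) by (simp add: fibre_linear_def subspace_scale[OF subspace_fibre])
  qed (auto simp: L0)
qed

lemma frame_expansion:
  assumes "(U,\<sigma>) \<in> trivs" "x \<in> U" "e \<in> E x"
  shows "e = (\<Sum>b\<in>Basis. (inv (\<sigma> x) e \<bullet> b) *\<^sub>R \<sigma> x b)"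
proof -
  have "e = \<sigma> x (\<Sum>b\<in>Basis. (inv (\<sigma> x) e \<bullet> b) *\<^sub>R b)"
    using triv_linear(6)[OF assms] by (simp add: euclidean_representation)
  then show ?thesis
    using triv_linear(1)[OF assms(1,2)] by (simp add: linear_sum linear_cmul)
qed

lemma section_in_fibre: "s \<in> \<Gamma> \<Longrightarrow> s x \<in> E x"
  by (simp add: \<Gamma>_def)

lemma section_coefficient_smooth:
  assumes "(U,\<sigma>) \<in> trivs" "s \<in> \<Gamma>"
  shows "smooth_fun_on U (\<lambda>x. inv (\<sigma> x) (s x) \<bullet> b)"
  using assms triv_open by (intro smooth_fun_on_inner smooth_fun_on_const) (auto simp: \<Gamma>_def)

text \<open>Smoothness of a fibrewise linear map, checked on a local frame, carries over to its values on
  sections. The metric, the complex structure and the anchor are all treated by this lemma.\<close>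

lemma smooth_fibre_map:
  assumes "(U,\<sigma>) \<in> trivs" "s \<in> \<Gamma>" "\<And>x. x \<in> U \<Longrightarrow> fibre_linear (E x) (L x)"
    and "\<And>b. smooth_fun_on U (\<lambda>x. L x (\<sigma> x b))"
  shows "smooth_fun_on U (\<lambda>x. L x (s x))"
proof (rule smooth_fun_on_cong)
  show U: "open U" using assms(1) triv_open by blast
  show "smooth_fun_on U (\<lambda>x. \<Sum>b\<in>Basis. (inv (\<sigma> x) (s x) \<bullet> b) *\<^sub>R L x (\<sigma> x b))"
    by (intro smooth_fun_on_sum smooth_fun_on_scaleR section_coefficient_smooth U assms)
  fix x assume x: "x \<in> U"
  show "(\<Sum>b\<in>Basis. (inv (\<sigma> x) (s x) \<bullet> b) *\<^sub>R L x (\<sigma> x b)) = L x (s x)"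
    using fibre_linear_sum[OF assms(3)[OF x], of Basis "\<sigma> x" "\<lambda>b. inv (\<sigma> x) (s x) \<bullet> b"]
      triv_linear(4)[OF assms(1) x] frame_expansion[OF assms(1) x section_in_fibre[OF assms(2)]]
    by simp
qed

lemma section_add: "s \<in> \<Gamma> \<Longrightarrow> t \<in> \<Gamma> \<Longrightarrow> s + t \<in> \<Gamma>"
proof -
  assume st: "s \<in> \<Gamma>" "t \<in> \<Gamma>"
  have "smooth_fun_on U (\<lambda>x. inv (\<sigma> x) (s x + t x))" if c: "(U,\<sigma>) \<in> trivs" for U \<sigma>
  proof (rule smooth_fun_on_cong)
    show U: "open U" using c triv_open by blast
    show "smooth_fun_on U (\<lambda>x. inv (\<sigma> x) (s x) + inv (\<sigma> x) (t x))"
      using st c by (intro smooth_fun_on_add U) (auto simp: \<Gamma>_def)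
    show "inv (\<sigma> x) (s x) + inv (\<sigma> x) (t x) = inv (\<sigma> x) (s x + t x)" if "x \<in> U" for x
      using triv_linear(7)[OF c that] st section_in_fibre by (auto simp: fibre_linear_def)
  qed
  then show ?thesis
    using st subspace_add[OF subspace_fibre] by (auto simp: \<Gamma>_def)
qed

lemma section_scale:
  assumes "f \<in> C_inf" "s \<in> \<Gamma>" shows "(\<lambda>x. f x *\<^sub>R s x) \<in> \<Gamma>"
proof -
  have "smooth_fun_on U (\<lambda>x. inv (\<sigma> x) (f x *\<^sub>R s x))" if c: "(U,\<sigma>) \<in> trivs" for U \<sigma>
  proof (rule smooth_fun_on_cong)
    show U: "open U" using c triv_open by blast
    show "smooth_fun_on U (\<lambda>x. f x *\<^sub>R inv (\<sigma> x) (s x))"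
      using assms c by (intro smooth_fun_on_scaleR U) (auto simp: \<Gamma>_def C_inf_def intro: smooth_fun_on_subset)
    show "f x *\<^sub>R inv (\<sigma> x) (s x) = inv (\<sigma> x) (f x *\<^sub>R s x)" if "x \<in> U" for x
      using triv_linear(7)[OF c that] assms section_in_fibre by (auto simp: fibre_linear_def)
  qed
  then show ?thesis
    using assms subspace_scale[OF subspace_fibre] by (auto simp: \<Gamma>_def)
qed

lemma section_minus: "s \<in> \<Gamma> \<Longrightarrow> - s \<in> \<Gamma>"
  using section_scale[OF C_inf_const[of "-1"], of s] by (simp add: fun_Compl_def)

lemma section_diff: "s \<in> \<Gamma> \<Longrightarrow> t \<in> \<Gamma> \<Longrightarrow> s - t \<in> \<Gamma>"
  using section_add[OF _ section_minus] by fastforce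

lemma section_frame:
  assumes "(U,\<sigma>) \<in> trivs" "f \<in> C_inf" "closed K" "K \<subseteq> U" "\<And>y. y \<notin> K \<Longrightarrow> f y = 0"
  shows "(\<lambda>x. f x *\<^sub>R \<sigma> x a) \<in> \<Gamma>"
proof -
  have "f x *\<^sub>R \<sigma> x a \<in> E x" for x
    using triv_linear(4)[OF assms(1)] assms(4,5) subspace_0[OF subspace_fibre] subspace_scale[OF subspace_fibre]
    by (cases "x \<in> K") auto
  moreover have "smooth_fun_on V (\<lambda>x. inv (\<tau> x) (f x *\<^sub>R \<sigma> x a))" if c: "(V,\<tau>) \<in> trivs" for V \<tau>
  proof (rule smooth_fun_on_cong)
    show V: "open V" using c triv_open by blast
    show "smooth_fun_on V (\<lambda>x. f x *\<^sub>R inv (\<tau> x) (\<sigma> x a))"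
      by (rule smooth_fun_on_cutoff[OF assms(2,3,4,5) triv_open[OF assms(1)] V trivs_compatible[OF assms(1) c]])
    show "f x *\<^sub>R inv (\<tau> x) (\<sigma> x a) = inv (\<tau> x) (f x *\<^sub>R \<sigma> x a)" if x: "x \<in> V" for x
    proof (cases "x \<in> U")
      case True
      then show ?thesis
        using triv_linear(7)[OF c x] triv_linear(4)[OF assms(1) True] by (auto simp: fibre_linear_def)
    next
      case False
      then have "f x = 0" using assms(4,5) by blast
      then show ?thesis
        using triv_linear(5)[OF c x, of 0] linear_0[OF triv_linear(1)[OF c x]] by simp
    qed
  qed
  ultimately show ?thesis by (auto simp: \<Gamma>_def)
qed

lemma section_through:
  assumes "e \<in> E x" obtains s where "s \<in> \<Gamma>" "s x = e"
proof -
  obtain U \<sigma> where c: "(U,\<sigma>) \<in> trivs" "x \<in> U" by (rule triv_at)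
  obtain f K where f: "f \<in> C_inf" "f x = 1" "closed K" "K \<subseteq> U" "\<And>y. y \<notin> K \<Longrightarrow> f y = 0"
    using bump_function[OF triv_open[OF c(1)] c(2)] by blast
  have "(\<lambda>y. f y *\<^sub>R \<sigma> y (inv (\<sigma> x) e)) \<in> \<Gamma>"
    using f by (intro section_frame[OF c(1)]) auto
  then show thesis
    by (rule that) (use f(2) triv_linear(6)[OF c assms] in simp)
qed

text \<open>Let \<open>f\<close> be a bump function at \<open>x\<close> in the domain of a local frame \<open>\<sigma> b\<close>. Then \<open>f\<^sup>2 s\<close> is the global
  combination of the sections \<open>f \<sigma> b\<close> with the global coefficients \<open>f s\<^sub>b\<close>, so \<open>T s = T (f\<^sup>2 s)\<close> is
  determined by the numbers \<open>s\<^sub>b x\<close>. No plateau of \<open>f\<close> and no locality of \<open>T\<close> is required.\<close>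

lemma tensorial_pointwise:
  fixes T :: "('p \<Rightarrow> 'v) \<Rightarrow> 'w::real_vector"
  assumes add: "\<And>s t. s \<in> \<Gamma> \<Longrightarrow> t \<in> \<Gamma> \<Longrightarrow> T (s + t) = T s + T t"
    and scale: "\<And>f s. f \<in> C_inf \<Longrightarrow> s \<in> \<Gamma> \<Longrightarrow> T (\<lambda>y. f y *\<^sub>R s y) = f x *\<^sub>R T s"
    and st: "s \<in> \<Gamma>" "t \<in> \<Gamma>" "s x = t x"
  shows "T s = T t"
proof -
  obtain U \<sigma> where c: "(U,\<sigma>) \<in> trivs" "x \<in> U" by (rule triv_at)
  obtain f K where f: "f \<in> C_inf" "f x = 1" "closed K" "K \<subseteq> U" "\<And>y. y \<notin> K \<Longrightarrow> f y = 0"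
    using bump_function[OF triv_open[OF c(1)] c(2)] by blast
  define e where "e b y = f y *\<^sub>R \<sigma> y b" for b y
  have e: "e b \<in> \<Gamma>" for b
    unfolding e_def using f by (intro section_frame[OF c(1)]) auto
  have sum: "(\<lambda>y. \<Sum>b\<in>B. k b y *\<^sub>R e b y) \<in> \<Gamma> \<and> T (\<lambda>y. \<Sum>b\<in>B. k b y *\<^sub>R e b y) = (\<Sum>b\<in>B. k b x *\<^sub>R T (e b))"
    if "finite B" "\<And>b. b \<in> B \<Longrightarrow> k b \<in> C_inf" for k :: "'f \<Rightarrow> 'p \<Rightarrow> real" and B
    using that
  proof induction
    case empty
    have "(\<lambda>y. 0 *\<^sub>R s y) \<in> \<Gamma>" "T (\<lambda>y. 0 *\<^sub>R s y) = 0 *\<^sub>R T s"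
      using section_scale[OF C_inf_const st(1)] scale[OF C_inf_const st(1)] by blast+
    then show ?case by simp
  next
    case (insert b B)
    have "(\<lambda>y. \<Sum>b\<in>insert b B. k b y *\<^sub>R e b y) = (\<lambda>y. k b y *\<^sub>R e b y) + (\<lambda>y. \<Sum>b\<in>B. k b y *\<^sub>R e b y)"
      using insert.hyps by (simp add: fun_eq_iff)
    moreover have "(\<lambda>y. k b y *\<^sub>R e b y) \<in> \<Gamma>"
      using section_scale insert.prems e by simp
    ultimately show ?case
      using insert add section_add scale e by simp
  qed
  have main: "T u = (\<Sum>b\<in>Basis. (inv (\<sigma> x) (u x) \<bullet> b) *\<^sub>R T (e b))" if u: "u \<in> \<Gamma>" for u
  proof -
    define k where "k b y = f y *\<^sub>R (inv (\<sigma> y) (u y) \<bullet> b)" for b y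
    have k: "k b \<in> C_inf" for b
      using smooth_fun_on_cutoff[OF f(1,3,4,5) triv_open[OF c(1)] open_UNIV, of "\<lambda>y. inv (\<sigma> y) (u y) \<bullet> b"]
        section_coefficient_smooth[OF c(1) u] by (simp add: C_inf_def k_def[abs_def])
    have "(f y * f y) *\<^sub>R u y = (\<Sum>b\<in>Basis. k b y *\<^sub>R e b y)" for y
    proof (cases "y \<in> K")
      case True
      then have "y \<in> U" using f(4) by blast
      then have "(f y * f y) *\<^sub>R u y = (f y * f y) *\<^sub>R (\<Sum>b\<in>Basis. (inv (\<sigma> y) (u y) \<bullet> b) *\<^sub>R \<sigma> y b)"
        using frame_expansion[OF c(1) _ section_in_fibre[OF u]] by simp
      also have "\<dots> = (\<Sum>b\<in>Basis. k b y *\<^sub>R e b y)"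
        by (simp add: scaleR_sum_right k_def e_def mult_ac)
      finally show ?thesis .
    qed (simp add: f(5) k_def)
    then have "T (\<lambda>y. (f * f) y *\<^sub>R u y) = (\<Sum>b\<in>Basis. k b x *\<^sub>R T (e b))"
      using sum[of Basis k] k by simp
    then show ?thesis
      using scale[OF C_inf_mult[OF f(1) f(1)] u] f(2) by (simp add: k_def)
  qed
  show ?thesis
    using main[OF st(1)] main[OF st(2)] st(3) by simp
qed

end


section \<open>Calculus in a Lie algebroid\<close>

context lie_algebroid
begin

text \<open>The action of functions on sections. Sums and negatives of sections and of functions are
  written with the pointwise operations on function types.\<close>

definition scale :: "('p \<Rightarrow> real) \<Rightarrow> ('p \<Rightarrow> 'v) \<Rightarrow> 'p \<Rightarrow> 'v" (infixr "\<odot>" 75) where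
  "f \<odot> s = (\<lambda>x. f x *\<^sub>R s x)"

text \<open>The derivative of a function along the anchor of a section.\<close>

definition act :: "('p \<Rightarrow> 'v) \<Rightarrow> ('p \<Rightarrow> real) \<Rightarrow> 'p \<Rightarrow> real" where
  "act s f = (\<lambda>x. rho x (s x) f)"

lemma scale_distribs:
  "f \<odot> (s + t) = f \<odot> s + f \<odot> t" "(f + h) \<odot> s = f \<odot> s + h \<odot> s" "f \<odot> (- s) = - (f \<odot> s)" "(- f) \<odot> s = - (f \<odot> s)"
  "f \<odot> (s - t) = f \<odot> s - f \<odot> t" "(f - h) \<odot> s = f \<odot> s - h \<odot> s"
  by (simp_all add: scale_def fun_eq_iff algebra_simps)

lemma act_closed [simp]:
  assumes "s \<in> \<Gamma>" "f \<in> C_inf" shows "act s f \<in> C_inf"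
proof -
  have "smooth_fun_on UNIV (\<lambda>x. rho x (s x) f)"
  proof (rule smooth_fun_on_local)
    fix x :: 'p
    obtain U \<sigma> where c: "(U,\<sigma>) \<in> trivs" "x \<in> U" by (rule triv_at)
    have "smooth_fun_on U (\<lambda>x. rho x (s x) f)"
      by (rule smooth_fibre_map[OF c(1) assms(1) anchor_linear anchor_smooth[OF c(1) assms(2)]])
    then show "\<exists>V. open V \<and> x \<in> V \<and> smooth_fun_on (UNIV \<inter> V) (\<lambda>x. rho x (s x) f)"
      using c triv_open by auto
  qed simp
  then show ?thesis by (simp add: C_inf_def act_def)
qed

lemma scale_section [simp]: "f \<in> C_inf \<Longrightarrow> s \<in> \<Gamma> \<Longrightarrow> f \<odot> s \<in> \<Gamma>"
  unfolding scale_def by (rule section_scale)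

lemmas [simp] = section_add section_minus section_diff br_closed C_inf_closed

lemma act_add: "s \<in> \<Gamma> \<Longrightarrow> f \<in> C_inf \<Longrightarrow> h \<in> C_inf \<Longrightarrow> act s (f + h) = act s f + act s h"
  and act_mult: "s \<in> \<Gamma> \<Longrightarrow> f \<in> C_inf \<Longrightarrow> h \<in> C_inf \<Longrightarrow> act s (f * h) = f * act s h + h * act s f"
  using anchor_tangent[OF section_in_fibre[of s]]
  by (simp_all add: act_def tangent_space_def plus_fun_def times_fun_def)

lemma act_const: assumes "s \<in> \<Gamma>" shows "act s (\<lambda>_. c) = 0"
proof
  fix x
  have v: "rho x (s x) \<in> tangent_space x"
    using anchor_tangent[OF section_in_fibre[OF assms]] .
  have "rho x (s x) (\<lambda>y. 1 * 1) = 1 * rho x (s x) (\<lambda>y. 1) + 1 * rho x (s x) (\<lambda>y. 1)"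
    using v C_inf_const[of 1] unfolding tangent_space_def mem_Collect_eq by meson
  then have "rho x (s x) (\<lambda>y. 1) = 0" by simp
  moreover have "rho x (s x) (\<lambda>y. c * 1) = c * rho x (s x) (\<lambda>y. 1)"
    using v C_inf_const[of 1] unfolding tangent_space_def mem_Collect_eq by meson
  ultimately show "act s (\<lambda>_. c) x = 0 x" by (simp add: act_def)
qed

lemma act_minus: assumes "s \<in> \<Gamma>" "f \<in> C_inf" shows "act s (- f) = - act s f"
proof -
  have "act s (- f + f) = act s (- f) + act s f" using assms by (intro act_add) auto
  moreover have "act s (- f + f) = 0" using act_const[OF assms(1), of 0] by (simp add: zero_fun_def)
  ultimately show ?thesis by (simp add: eq_neg_iff_add_eq_0)
qed

lemma act_br: "s \<in> \<Gamma> \<Longrightarrow> t \<in> \<Gamma> \<Longrightarrow> f \<in> C_inf \<Longrightarrow> act (br s t) f = act s (act t f) - act t (act s f)"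
  using anchor_br by (simp add: act_def fun_eq_iff)

lemma br_skew': "s \<in> \<Gamma> \<Longrightarrow> t \<in> \<Gamma> \<Longrightarrow> br t s = - br s t"
  using br_skew[of t s] by (simp add: fun_Compl_def)

lemma br_scale_right: "s \<in> \<Gamma> \<Longrightarrow> t \<in> \<Gamma> \<Longrightarrow> f \<in> C_inf \<Longrightarrow> br s (f \<odot> t) = f \<odot> br s t + act s f \<odot> t"
  using br_leibniz[of s t f] by (simp add: scale_def act_def plus_fun_def)

lemma br_scale_fun_left:
  "s \<in> \<Gamma> \<Longrightarrow> t \<in> \<Gamma> \<Longrightarrow> f \<in> C_inf \<Longrightarrow> br (f \<odot> s) t = f \<odot> br s t - act t f \<odot> s"
  using br_skew'[of t "f \<odot> s"] br_scale_right[of t s f] br_skew'[of s t] by (simp add: scale_distribs)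

end


section \<open>The Levi-Civita connection and its curvature\<close>

context hermitian_lie_algebroid
begin

text \<open>The metric as a form on sections with values in functions.\<close>

definition G :: "('p \<Rightarrow> 'v) \<Rightarrow> ('p \<Rightarrow> 'v) \<Rightarrow> 'p \<Rightarrow> real" where
  "G s t = (\<lambda>x. g x (s x) (t x))"

lemma G_sym: "s \<in> \<Gamma> \<Longrightarrow> t \<in> \<Gamma> \<Longrightarrow> G s t = G t s"
  using g_sym section_in_fibre by (simp add: G_def fun_eq_iff)

lemma G_add_right: "s \<in> \<Gamma> \<Longrightarrow> t \<in> \<Gamma> \<Longrightarrow> u \<in> \<Gamma> \<Longrightarrow> G s (t + u) = G s t + G s u"
  and G_scale_right: "s \<in> \<Gamma> \<Longrightarrow> t \<in> \<Gamma> \<Longrightarrow> G s (f \<odot> t) = f * G s t"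
  using g_linear section_in_fibre by (simp_all add: G_def fun_eq_iff fibre_linear_def scale_def)

lemma G_add_left: "s \<in> \<Gamma> \<Longrightarrow> t \<in> \<Gamma> \<Longrightarrow> u \<in> \<Gamma> \<Longrightarrow> G (s + t) u = G s u + G t u"
  using G_sym[of _ u] by (simp add: G_add_right)

lemma G_scale_left: "f \<in> C_inf \<Longrightarrow> s \<in> \<Gamma> \<Longrightarrow> t \<in> \<Gamma> \<Longrightarrow> G (f \<odot> s) t = f * G s t"
  using G_sym[of _ t] by (simp add: G_scale_right)

lemma G_minus_right: "s \<in> \<Gamma> \<Longrightarrow> t \<in> \<Gamma> \<Longrightarrow> G s (- t) = - G s t"
  using G_scale_right[of s t "\<lambda>_. -1"] by (simp add: scale_def fun_eq_iff G_def)

lemma G_minus_left: "s \<in> \<Gamma> \<Longrightarrow> t \<in> \<Gamma> \<Longrightarrow> G (- s) t = - G s t"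
  using G_sym[of _ t] by (simp add: G_minus_right)

lemma G_diff_left: "s \<in> \<Gamma> \<Longrightarrow> t \<in> \<Gamma> \<Longrightarrow> u \<in> \<Gamma> \<Longrightarrow> G (s - t) u = G s u - G t u"
  using G_add_left[of s "- t" u] G_minus_left[of t u] by simp

lemma G_diff_right: "s \<in> \<Gamma> \<Longrightarrow> t \<in> \<Gamma> \<Longrightarrow> u \<in> \<Gamma> \<Longrightarrow> G s (t - u) = G s t - G s u"
  using G_add_right[of s t "- u"] G_minus_right[of s u] by simp

lemma G_zero_left: "s \<in> \<Gamma> \<Longrightarrow> G 0 s = 0"
  using G_diff_left[of s s s] by simp

lemmas G_distribs = G_add_left G_add_right G_minus_left G_minus_right G_diff_left G_diff_right

lemma G_closed [simp]:
  assumes "s \<in> \<Gamma>" "t \<in> \<Gamma>" shows "G s t \<in> C_inf"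
proof -
  have "smooth_fun_on UNIV (\<lambda>x. g x (s x) (t x))"
  proof (rule smooth_fun_on_local)
    fix x :: 'p
    obtain U \<sigma> where c: "(U,\<sigma>) \<in> trivs" "x \<in> U" by (rule triv_at)
    have "smooth_fun_on U (\<lambda>y. g y (\<sigma> y a) (t y))" for a
      by (rule smooth_fibre_map[OF c(1) assms(2) g_linear g_smooth[OF c(1)]])
        (use triv_linear(4)[OF c(1)] in blast)
    moreover have "fibre_linear (E y) (\<lambda>e. g y e (t y))" for y
      using g_linear[of "t y" y] section_in_fibre[OF assms(2), of y] subspace_add[OF subspace_fibre[of y]]
        subspace_scale[OF subspace_fibre[of y]] unfolding fibre_linear_def
      by (metis g_sym section_in_fibre[OF assms(2)])
    ultimately have "smooth_fun_on U (\<lambda>y. g y (s y) (t y))"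
      by (intro smooth_fibre_map[where L = "\<lambda>y e. g y e (t y)", OF c(1) assms(1)])
    then show "\<exists>V. open V \<and> x \<in> V \<and> smooth_fun_on (UNIV \<inter> V) (\<lambda>x. g x (s x) (t x))"
      using c triv_open by auto
  qed simp
  then show ?thesis by (simp add: C_inf_def G_def)
qed

lemma G_pos: "s \<in> \<Gamma> \<Longrightarrow> s x \<noteq> 0 \<Longrightarrow> G s s x > 0"
  using g_pos section_in_fibre by (simp add: G_def)

lemma G_nondegenerate:
  assumes "s \<in> \<Gamma>" "\<And>t x. t \<in> \<Gamma> \<Longrightarrow> G s t x = 0" shows "s = 0"
  using G_pos[OF assms(1)] assms(2)[OF assms(1)] by (metis ext less_irrefl zero_fun_apply)

lemma Js_closed [simp]:
  assumes "s \<in> \<Gamma>" shows "Js s \<in> \<Gamma>"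
proof -
  have "smooth_fun_on U (\<lambda>x. inv (\<sigma> x) (J x (s x)))" if c: "(U,\<sigma>) \<in> trivs" for U \<sigma>
  proof (rule smooth_fibre_map[where L = "\<lambda>x e. inv (\<sigma> x) (J x e)", OF c assms _ J_smooth[OF c]])
    fix x assume "x \<in> U"
    then show "fibre_linear (E x) (\<lambda>e. inv (\<sigma> x) (J x e))"
      using triv_linear(7)[OF c] J_linear J_closed by (simp add: fibre_linear_def)
  qed
  then show ?thesis
    using J_closed section_in_fibre[OF assms] by (auto simp: \<Gamma>_def Js_def)
qed

lemma Js_add: "s \<in> \<Gamma> \<Longrightarrow> t \<in> \<Gamma> \<Longrightarrow> Js (s + t) = Js s + Js t"
  and Js_scale: "s \<in> \<Gamma> \<Longrightarrow> Js (f \<odot> s) = f \<odot> Js s"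
  and Js_Js [simp]: "s \<in> \<Gamma> \<Longrightarrow> Js (Js s) = - s"
  using J_linear section_in_fibre J_squared by (simp_all add: Js_def fun_eq_iff fibre_linear_def scale_def)

lemma Js_minus: "s \<in> \<Gamma> \<Longrightarrow> Js (- s) = - Js s"
  using Js_scale[of s "\<lambda>_. -1"] by (simp add: scale_def fun_eq_iff Js_def)

lemma Js_diff: "s \<in> \<Gamma> \<Longrightarrow> t \<in> \<Gamma> \<Longrightarrow> Js (s - t) = Js s - Js t"
  using Js_add[of s "- t"] Js_minus[of t] by simp

lemma G_Js_Js [simp]: "s \<in> \<Gamma> \<Longrightarrow> t \<in> \<Gamma> \<Longrightarrow> G (Js s) (Js t) = G s t"
  using g_hermitian section_in_fibre by (simp add: Js_def G_def fun_eq_iff)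

lemma G_Js_left: "s \<in> \<Gamma> \<Longrightarrow> t \<in> \<Gamma> \<Longrightarrow> G (Js s) t = - G s (Js t)"
  using G_Js_Js[of s "Js t"] by (simp add: G_distribs equation_minus_iff)

lemma levi_civitaD:
  assumes "levi_civita D"
  shows "s \<in> \<Gamma> \<Longrightarrow> t \<in> \<Gamma> \<Longrightarrow> D s t \<in> \<Gamma>"
    "s \<in> \<Gamma> \<Longrightarrow> t \<in> \<Gamma> \<Longrightarrow> u \<in> \<Gamma> \<Longrightarrow> D (s + t) u = D s u + D t u"
    "s \<in> \<Gamma> \<Longrightarrow> t \<in> \<Gamma> \<Longrightarrow> u \<in> \<Gamma> \<Longrightarrow> D s (t + u) = D s t + D s u"
    "f \<in> C_inf \<Longrightarrow> s \<in> \<Gamma> \<Longrightarrow> t \<in> \<Gamma> \<Longrightarrow> D (f \<odot> s) t = f \<odot> D s t"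
    "f \<in> C_inf \<Longrightarrow> s \<in> \<Gamma> \<Longrightarrow> t \<in> \<Gamma> \<Longrightarrow> D s (f \<odot> t) = act s f \<odot> t + f \<odot> D s t"
    "s \<in> \<Gamma> \<Longrightarrow> t \<in> \<Gamma> \<Longrightarrow> u \<in> \<Gamma> \<Longrightarrow> act s (G t u) = G (D s t) u + G t (D s u)"
    "s \<in> \<Gamma> \<Longrightarrow> t \<in> \<Gamma> \<Longrightarrow> br s t = D s t - D t s"
  using assms
  by (simp_all add: levi_civita_def linear_connection_def plus_fun_def fun_diff_def scale_def act_def G_def)

text \<open>The difference \<open>A\<close> of two Levi-Civita connections is symmetric in its arguments, and
  \<open>g(A(X,Y),Z)\<close> is skew in \<open>Y\<close> and \<open>Z\<close>; a trilinear form with both properties is zero.\<close>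

lemma levi_civita_unique:
  assumes D: "levi_civita D" "levi_civita D'" and st: "s \<in> \<Gamma>" "t \<in> \<Gamma>"
  shows "D s t = D' s t"
proof -
  define A where "A X Y = D X Y - D' X Y" for X Y
  have A: "A X Y \<in> \<Gamma>" if "X \<in> \<Gamma>" "Y \<in> \<Gamma>" for X Y
    using that levi_civitaD(1)[OF D(1)] levi_civitaD(1)[OF D(2)] by (simp add: A_def)
  have sym: "A X Y = A Y X" if "X \<in> \<Gamma>" "Y \<in> \<Gamma>" for X Y
    using levi_civitaD(7)[OF D(1) that] levi_civitaD(7)[OF D(2) that]
    by (simp add: A_def algebra_simps)
  have skew: "G (A X Y) Z x = - G (A X Z) Y x" if "X \<in> \<Gamma>" "Y \<in> \<Gamma>" "Z \<in> \<Gamma>" for X Y Z x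
  proof -
    have "G (D X Y) Z x + G Y (D X Z) x = G (D' X Y) Z x + G Y (D' X Z) x"
      using fun_cong[OF levi_civitaD(6)[OF D(1) that], of x] fun_cong[OF levi_civitaD(6)[OF D(2) that], of x]
      by simp
    then show ?thesis
      using that levi_civitaD(1)[OF D(1)] levi_civitaD(1)[OF D(2)] G_sym[of Y]
      by (simp add: A_def G_distribs)
  qed
  have "A s t = 0"
  proof (rule G_nondegenerate[OF A[OF st]])
    fix u x assume u: "u \<in> \<Gamma>"
    show "G (A s t) u x = 0"
      using skew[of s t u x] skew[of u s t x] skew[of t u s x] sym[of s u] sym[of u t] sym[of t s] st u
      by simp
  qed
  then show ?thesis by (simp add: A_def)
qed

end

text \<open>A Hermitian Lie algebroid with a Levi-Civita connection.\<close>

locale hermitian_levi_civita = hermitian_lie_algebroid charts E trivs rho br J g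
  for charts :: "('p::{t2_space,second_countable_topology} set \<times> ('p \<Rightarrow> 'b::real_inner)) set"
    and E :: "'p \<Rightarrow> 'v::real_vector set"
    and trivs :: "('p set \<times> ('p \<Rightarrow> 'f::euclidean_space \<Rightarrow> 'v)) set"
    and rho :: "'p \<Rightarrow> 'v \<Rightarrow> ('p \<Rightarrow> real) \<Rightarrow> real"
    and br :: "('p \<Rightarrow> 'v) \<Rightarrow> ('p \<Rightarrow> 'v) \<Rightarrow> ('p \<Rightarrow> 'v)"
    and J :: "'p \<Rightarrow> 'v \<Rightarrow> 'v"
    and g :: "'p \<Rightarrow> 'v \<Rightarrow> 'v \<Rightarrow> real" +
  fixes D :: "('p \<Rightarrow> 'v) \<Rightarrow> ('p \<Rightarrow> 'v) \<Rightarrow> ('p \<Rightarrow> 'v)"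
  assumes levi_civita: "levi_civita D"
begin

lemmas D_closed [simp] = levi_civitaD(1)[OF levi_civita]
lemmas D_add = levi_civitaD(2,3)[OF levi_civita]
lemmas D_scale = levi_civitaD(4,5)[OF levi_civita]
lemmas D_metric = levi_civitaD(6)[OF levi_civita]
lemmas D_torsion = levi_civitaD(7)[OF levi_civita]

lemma D_minus:
  assumes "s \<in> \<Gamma>" "t \<in> \<Gamma>"
  shows "D (- s) t = - D s t" "D s (- t) = - D s t"
proof -
  have neg: "(\<lambda>_. -1) \<odot> u = - u" and zero: "0 \<odot> u = 0" for u
    by (simp_all add: scale_def fun_eq_iff)
  show "D (- s) t = - D s t" "D s (- t) = - D s t"
    using D_scale[OF C_inf_const[of "-1"] assms] unfolding neg act_const[OF assms(1)] zero by simp_all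
qed

lemma D_diff:
  "s \<in> \<Gamma> \<Longrightarrow> t \<in> \<Gamma> \<Longrightarrow> u \<in> \<Gamma> \<Longrightarrow> D (s - t) u = D s u - D t u"
  "s \<in> \<Gamma> \<Longrightarrow> t \<in> \<Gamma> \<Longrightarrow> u \<in> \<Gamma> \<Longrightarrow> D s (t - u) = D s t - D s u"
  using D_add(1)[of s "- t" u] D_add(2)[of s t "- u"] D_minus by simp_all

lemmas D_distribs = D_add D_minus D_diff

abbreviation R :: "('p \<Rightarrow> 'v) \<Rightarrow> ('p \<Rightarrow> 'v) \<Rightarrow> ('p \<Rightarrow> 'v) \<Rightarrow> 'p \<Rightarrow> 'v" where
  "R \<equiv> curvature D"

text \<open>The curvature as a quadrilinear form, in the order \<open>Q X Y Z W = g(R(X,Y)Z, W)\<close>.\<close>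

definition Q :: "('p \<Rightarrow> 'v) \<Rightarrow> ('p \<Rightarrow> 'v) \<Rightarrow> ('p \<Rightarrow> 'v) \<Rightarrow> ('p \<Rightarrow> 'v) \<Rightarrow> 'p \<Rightarrow> real" where
  "Q X Y Z W = G (R X Y Z) W"

lemma R_br: "R X Y Z = D X (D Y Z) - D Y (D X Z) - D (br X Y) Z"
  by (simp add: curvature_def fun_eq_iff)

text \<open>Freedom from torsion removes the bracket, which turns the Bianchi identities into additive
  identities between iterated covariant derivatives, modulo the Jacobi identity.\<close>

lemma R_eq: "X \<in> \<Gamma> \<Longrightarrow> Y \<in> \<Gamma> \<Longrightarrow> Z \<in> \<Gamma> \<Longrightarrow>
    R X Y Z = D X (D Y Z) - D Y (D X Z) - (D (D X Y) Z - D (D Y X) Z)"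
  by (simp add: R_br D_torsion D_distribs)

lemma R_closed [simp]: "X \<in> \<Gamma> \<Longrightarrow> Y \<in> \<Gamma> \<Longrightarrow> Z \<in> \<Gamma> \<Longrightarrow> R X Y Z \<in> \<Gamma>"
  by (simp add: R_br)

lemma R_skew: "X \<in> \<Gamma> \<Longrightarrow> Y \<in> \<Gamma> \<Longrightarrow> Z \<in> \<Gamma> \<Longrightarrow> R X Y Z = - R Y X Z"
  by (simp add: R_eq)

lemma R_add: "X \<in> \<Gamma> \<Longrightarrow> X' \<in> \<Gamma> \<Longrightarrow> Y \<in> \<Gamma> \<Longrightarrow> Z \<in> \<Gamma> \<Longrightarrow> R (X + X') Y Z = R X Y Z + R X' Y Z"
  by (simp add: R_eq D_distribs)

lemma R_scale:
  assumes "f \<in> C_inf" "X \<in> \<Gamma>" "Y \<in> \<Gamma>" "Z \<in> \<Gamma>" shows "R (f \<odot> X) Y Z = f \<odot> R X Y Z"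
  using assms by (simp add: R_br br_scale_fun_left D_scale D_distribs scale_distribs)

lemma jacobi:
  assumes "X \<in> \<Gamma>" "Y \<in> \<Gamma>" "Z \<in> \<Gamma>"
  shows "br X (br Y Z) + br Y (br Z X) + br Z (br X Y) = 0"
  using br_jacobi[OF assms] by (simp add: plus_fun_def zero_fun_def)

lemma bianchi_1:
  assumes "X \<in> \<Gamma>" "Y \<in> \<Gamma>" "Z \<in> \<Gamma>"
  shows "R X Y Z + R Y Z X + R Z X Y = 0"
  using jacobi[OF assms] assms by (simp add: R_eq D_torsion D_distribs algebra_simps)

text \<open>The cyclic sum over \<open>U\<close>, \<open>X\<close>, \<open>Y\<close> of the covariant derivatives \<open>(D\<^sub>U R)(X,Y)Z\<close>.\<close>

lemma bianchi_2:
  assumes "U \<in> \<Gamma>" "X \<in> \<Gamma>" "Y \<in> \<Gamma>" "Z \<in> \<Gamma>"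
  shows "(D U (R X Y Z) - R (D U X) Y Z - R X (D U Y) Z - R X Y (D U Z))
    + (D X (R Y U Z) - R (D X Y) U Z - R Y (D X U) Z - R Y U (D X Z))
    + (D Y (R U X Z) - R (D Y U) X Z - R U (D Y X) Z - R U X (D Y Z)) = 0"
proof -
  have "D 0 Z = 0"
    using D_diff(1)[of U U Z] assms by simp
  then have "D (br U (br X Y) + br X (br Y U) + br Y (br U X)) Z = 0"
    using jacobi[OF assms(1,2,3)] by simp
  then show ?thesis
    using assms by (simp add: R_eq D_torsion D_distribs algebra_simps)
qed

lemma Q_closed [simp]:
  "X \<in> \<Gamma> \<Longrightarrow> Y \<in> \<Gamma> \<Longrightarrow> Z \<in> \<Gamma> \<Longrightarrow> W \<in> \<Gamma> \<Longrightarrow> Q X Y Z W \<in> C_inf"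
  by (simp add: Q_def)

lemma Q_skew: "X \<in> \<Gamma> \<Longrightarrow> Y \<in> \<Gamma> \<Longrightarrow> Z \<in> \<Gamma> \<Longrightarrow> W \<in> \<Gamma> \<Longrightarrow> Q X Y Z W = - Q Y X Z W"
  using R_skew[of X Y Z] by (simp add: Q_def G_distribs)

text \<open>This is the statement that \<open>[X,Y]\<close> acts on the function \<open>g(Z,W)\<close> as a commutator.\<close>

lemma Q_skew_34:
  assumes "X \<in> \<Gamma>" "Y \<in> \<Gamma>" "Z \<in> \<Gamma>" "W \<in> \<Gamma>"
  shows "Q X Y Z W = - Q X Y W Z"
proof -
  have "act X (act Y (G Z W)) - act Y (act X (G Z W)) - act (br X Y) (G Z W) = 0"
    using assms by (simp add: act_br)
  then have "G (R X Y Z) W + G Z (R X Y W) = 0"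
    using assms by (simp add: D_metric act_add R_br G_distribs algebra_simps)
  then show ?thesis
    using assms G_sym[of Z "R X Y W"] by (simp add: Q_def eq_neg_iff_add_eq_0)
qed

text \<open>Add the first Bianchi identity for the four cyclic arrangements of the arguments.\<close>

lemma Q_pair:
  assumes "X \<in> \<Gamma>" "Y \<in> \<Gamma>" "Z \<in> \<Gamma>" "W \<in> \<Gamma>"
  shows "Q X Y Z W = Q Z W X Y"
proof
  fix x
  have b: "Q A B C F x + Q B C A F x + Q C A B F x = 0"
    if "A \<in> \<Gamma>" "B \<in> \<Gamma>" "C \<in> \<Gamma>" "F \<in> \<Gamma>" for A B C F
    using arg_cong[OF bianchi_1[OF that(1,2,3)], of "\<lambda>s. G s F x"] that
G_zero_left[OF that(4)]
    by (simp add: Q_def G_add_left)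
  have s: "Q A B C F x = - Q B A C F x" "Q A B C F x = - Q A B F C x"
    if "A \<in> \<Gamma>" "B \<in> \<Gamma>" "C \<in> \<Gamma>" "F \<in> \<Gamma>" for A B C F
    using Q_skew[OF that] Q_skew_34[OF that] by simp_all
  show "Q X Y Z W x = Q Z W X Y x"
    using b[OF assms(2,3,1,4)] b[OF assms(3,1,4,2)] b[OF assms(1,4,2,3)] b[OF assms(4,2,3,1)]
      s(2)[OF assms(2,3,4,1)] s(2)[OF assms(3,1,4,2)] s(2)[OF assms(1,4,3,2)] s(2)[OF assms(4,2,1,3)]
      s[OF assms(2,1,4,3)] s(2)[OF assms(1,2,4,3)] s[OF assms(3,4,2,1)] s(2)[OF assms(4,3,2,1)] s(1)[OF assms(4,3,1,2)]
    by linarith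
qed

lemma Q_add: "X \<in> \<Gamma> \<Longrightarrow> X' \<in> \<Gamma> \<Longrightarrow> Y \<in> \<Gamma> \<Longrightarrow> Z \<in> \<Gamma> \<Longrightarrow> W \<in> \<Gamma> \<Longrightarrow>
    Q (X + X') Y Z W = Q X Y Z W + Q X' Y Z W"
  by (simp add: Q_def R_add G_add_left)

lemma Q_scale: "f \<in> C_inf \<Longrightarrow> X \<in> \<Gamma> \<Longrightarrow> Y \<in> \<Gamma> \<Longrightarrow> Z \<in> \<Gamma> \<Longrightarrow> W \<in> \<Gamma> \<Longrightarrow>
    Q (f \<odot> X) Y Z W = f * Q X Y Z W"
  by (simp add: Q_def R_scale G_scale_left)

lemma riem_eq: "s1 \<in> \<Gamma> \<Longrightarrow> s2 \<in> \<Gamma> \<Longrightarrow> s3 \<in> \<Gamma> \<Longrightarrow> s4 \<in> \<Gamma> \<Longrightarrow> riem D s1 s2 s3 s4 = Q s3 s4 s2 s1"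
  by (simp add: riem_def fun_eq_iff Q_def G_def)

end


section \<open>Sectional curvature in terms of sections\<close>

context hermitian_levi_civita
begin

text \<open>Tensoriality in the first slot suffices: skew symmetry and pair symmetry move the other slots
  there.\<close>

lemma Q_pointwise:
  assumes "X \<in> \<Gamma>" "Y \<in> \<Gamma>" "X' \<in> \<Gamma>" "Y' \<in> \<Gamma>" "X x = X' x" "Y x = Y' x"
  shows "Q X Y Y X x = Q X' Y' Y' X' x"
proof -
  have 1: "Q A B C F x = Q A' B C F x"
    if "A \<in> \<Gamma>" "A' \<in> \<Gamma>" "B \<in> \<Gamma>" "C \<in> \<Gamma>" "F \<in> \<Gamma>" "A x = A' x" for A A' B C F
    by (rule tensorial_pointwise[where T = "\<lambda>s. Q s B C F x" and s = A and t = A' and x = x])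
      (use that Q_add Q_scale in \<open>auto simp: scale_def[symmetric]\<close>)
  have 2: "Q B A C F x = Q B A' C F x"
    if "A \<in> \<Gamma>" "A' \<in> \<Gamma>" "B \<in> \<Gamma>" "C \<in> \<Gamma>" "F \<in> \<Gamma>" "A x = A' x" for A A' B C F
    using 1[OF that] Q_skew[of A B C F] Q_skew[of A' B C F] that by simp
  have "Q X Y Y X x = Q X' Y' Y X x"
    using 1[of X X' Y Y X] 2[of Y Y' X' Y X] assms by simp
  also have "\<dots> = Q Y X X' Y' x"
    using Q_pair assms by simp
  also have "\<dots> = Q Y' X' X' Y' x"
    using 1[of Y Y' X X' Y'] 2[of X X' Y' X' Y'] assms by simp
  also have "\<dots> = Q X' Y' Y' X' x"
    using Q_pair assms by simp
  finally show ?thesis .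
qed

text \<open>A change of basis of the plane multiplies numerator and denominator by the square of its
  determinant. The second basis is first replaced by constant combinations \<open>t1\<close>, \<open>t2\<close> of \<open>X\<close> and \<open>Y\<close>
  with the same values at \<open>x\<close>.\<close>

lemma sectional_curvature_eq:
  assumes "X \<in> \<Gamma>" "Y \<in> \<Gamma>" "X x \<noteq> Y x" "independent {X x, Y x}"
  shows "sectional_curvature x (span {X x, Y x}) =
    Q X Y Y X x / (G X X x * G Y Y x - (G X Y x)\<^sup>2)"
  unfolding sectional_curvature_def
proof (rule the_equality)
  show "\<exists>D s1 s2. levi_civita D \<and> s1 \<in> \<Gamma> \<and> s2 \<in> \<Gamma> \<and> s1 x \<noteq> s2 x \<and> independent {s1 x, s2 x} \<and>
      span {s1 x, s2 x} = span {X x, Y x} \<and>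
      Q X Y Y X x / (G X X x * G Y Y x - (G X Y x)\<^sup>2) =
      riem D s1 s2 s1 s2 x / (g x (s1 x) (s1 x) * g x (s2 x) (s2 x) - (g x (s1 x) (s2 x))\<^sup>2)"
    using assms levi_civita riem_eq[of X Y X Y]
    by (intro exI[of _ D] exI[of _ X] exI[of _ Y]) (simp add: G_def)
next
  fix k
  assume "\<exists>D s1 s2. levi_civita D \<and> s1 \<in> \<Gamma> \<and> s2 \<in> \<Gamma> \<and> s1 x \<noteq> s2 x \<and> independent {s1 x, s2 x} \<and>
      span {s1 x, s2 x} = span {X x, Y x} \<and>
      k = riem D s1 s2 s1 s2 x / (g x (s1 x) (s1 x) * g x (s2 x) (s2 x) - (g x (s1 x) (s2 x))\<^sup>2)"
  then obtain D' s1 s2 where D': "levi_civita D'" and s: "s1 \<in> \<Gamma>" "s2 \<in> \<Gamma>" "s1 x \<noteq> s2 x"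
    "independent {s1 x, s2 x}" "span {s1 x, s2 x} = span {X x, Y x}"
    and k: "k = riem D' s1 s2 s1 s2 x / (g x (s1 x) (s1 x) * g x (s2 x) (s2 x) - (g x (s1 x) (s2 x))\<^sup>2)"
    by blast
  have DD: "D' u v = D u v" if "u \<in> \<Gamma>" "v \<in> \<Gamma>" for u v
    using levi_civita_unique[OF D' levi_civita that] .
  have "riem D' s1 s2 s1 s2 x = riem D s1 s2 s1 s2 x"
    using s by (simp add: riem_def curvature_def DD)
  then have k': "k = Q s1 s2 s2 s1 x / (G s1 s1 x * G s2 s2 x - (G s1 s2 x)\<^sup>2)"
    using k s by (simp add: riem_eq G_def)
  have "\<exists>a b. s1 x = a *\<^sub>R X x + b *\<^sub>R Y x" "\<exists>a b. s2 x = a *\<^sub>R X x + b *\<^sub>R Y x"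
    using s(5) span_superset[of "{s1 x, s2 x}"] by (auto simp: span_insert span_singleton algebra_simps)
  then obtain a b c d where ab: "s1 x = a *\<^sub>R X x + b *\<^sub>R Y x" and cd: "s2 x = c *\<^sub>R X x + d *\<^sub>R Y x"
    by blast
  define K where "K f s = (\<lambda>_. f :: real) \<odot> s" for f s
  define t1 t2 where "t1 = K a X + K b Y" and "t2 = K c X + K d Y"
  have t: "t1 \<in> \<Gamma>" "t2 \<in> \<Gamma>" "s1 x = t1 x" "s2 x = t2 x"
    using assms ab cd by (simp_all add: t1_def t2_def K_def) (simp_all add: scale_def)
  have K: "K f s \<in> \<Gamma>" if "s \<in> \<Gamma>" for f s
    using that by (simp add: K_def)
  have q1: "Q (K a A + K b B) C F H = (\<lambda>x. a * Q A C F H x + b * Q B C F H x)"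
    if "A \<in> \<Gamma>" "B \<in> \<Gamma>" "C \<in> \<Gamma>" "F \<in> \<Gamma>" "H \<in> \<Gamma>" for a b A B C F H
    using that by (simp add: K_def Q_add Q_scale fun_eq_iff)
  have q2: "Q C (K a A + K b B) F H = (\<lambda>x. a * Q C A F H x + b * Q C B F H x)"
    if "A \<in> \<Gamma>" "B \<in> \<Gamma>" "C \<in> \<Gamma>" "F \<in> \<Gamma>" "H \<in> \<Gamma>" for a b A B C F H
    using q1[OF that, of a b] Q_skew[of C _ F H] that K by (simp add: fun_eq_iff)
  have QQ: "Q A A B C x = 0" if "A \<in> \<Gamma>" "B \<in> \<Gamma>" "C \<in> \<Gamma>" for A B C
    using fun_cong[OF Q_skew[of A A B C], of x] that by simp
  have det: "Q t1 t2 F H x = (a * d - b * c) * Q X Y F H x" if "F \<in> \<Gamma>" "H \<in> \<Gamma>" for F H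
  proof -
    have "Q t1 t2 F H x = a * (c * Q X X F H x + d * Q X Y F H x) + b * (c * Q Y X F H x + d * Q Y Y F H x)"
      unfolding t1_def t2_def using assms K that by (simp add: q1 q2 algebra_simps)
    then show ?thesis
      using QQ that assms fun_cong[OF Q_skew[of Y X F H], of x] by (simp add: algebra_simps)
  qed
  have "Q s1 s2 s2 s1 x = Q t1 t2 t2 t1 x"
    using s t by (intro Q_pointwise) auto
  also have "\<dots> = (a * d - b * c) * - Q t1 t2 X Y x"
    using det[OF t(2,1)] Q_pair[of X Y t2 t1] Q_skew[of t2 t1 X Y] t assms by simp
  also have "\<dots> = (a * d - b * c)\<^sup>2 * Q X Y Y X x"
    using det[OF assms(1,2)] fun_cong[OF Q_skew_34[of X Y X Y], of x] assms
    by (simp add: power2_eq_square)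
  finally have num: "Q s1 s2 s2 s1 x = (a * d - b * c)\<^sup>2 * Q X Y Y X x" .
  have Gt: "G s1 s1 x = G t1 t1 x" "G s2 s2 x = G t2 t2 x" "G s1 s2 x = G t1 t2 x"
    using t by (simp_all add: G_def)
  have den: "G s1 s1 x * G s2 s2 x - (G s1 s2 x)\<^sup>2 =
      (a * d - b * c)\<^sup>2 * (G X X x * G Y Y x - (G X Y x)\<^sup>2)"
    unfolding Gt unfolding t1_def t2_def K_def
    using assms G_sym[of Y X]
    by (simp add: G_add_left G_add_right G_scale_left G_scale_right power2_eq_square algebra_simps)
  have "a * d - b * c \<noteq> 0"
  proof
    assume "a * d - b * c = 0"
    then have e: "d *\<^sub>R s1 x + (- b) *\<^sub>R s2 x = 0" "(- c) *\<^sub>R s1 x + a *\<^sub>R s2 x = 0"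
      unfolding ab cd by (simp_all add: algebra_simps scaleR_left_distrib[symmetric] flip: scaleR_left_diff_distrib)
    have ind: "u = 0 \<and> v = 0" if "u *\<^sub>R s1 x + v *\<^sub>R s2 x = 0" for u v
    proof -
      have "u = 0"
        using independentD[OF s(4), of "{s1 x, s2 x}" "\<lambda>w. if w = s1 x then u else v" "s1 x"] s(3) that by simp
      moreover have "v = 0"
        using independentD[OF s(4), of "{s1 x, s2 x}" "\<lambda>w. if w = s1 x then u else v" "s2 x"] s(3) that
        by (auto split: if_splits)
      ultimately show ?thesis ..
    qed
    have "s1 x = 0" "s2 x = 0"
      using ind[OF e(1)] ind[OF e(2)] ab cd by auto
    then show False using s(3) by simp
  qed
  then show "k = Q X Y Y X x / (G X X x * G Y Y x - (G X Y x)\<^sup>2)"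
    unfolding k' num den by simp
qed

lemma holomorphic_plane_of_section:
  assumes "X \<in> \<Gamma>" "X x \<noteq> 0"
  shows "span {X x, Js X x} \<in> holomorphic_planes x"
    "sectional_curvature x (span {X x, Js X x}) = Q X (Js X) (Js X) X x / (G X X x)\<^sup>2"
proof -
  have GX: "G X (Js X) x = 0"
    using fun_cong[OF G_Js_left[of X X], of x] fun_cong[OF G_sym[of X "Js X"], of x] assms(1) by simp
  have ne: "X x \<noteq> Js X x"
    using GX G_pos[OF assms] by (auto simp: G_def)
  have "\<not> (\<exists>k. Js X x = k *\<^sub>R X x)"
  proof
    assume "\<exists>k. Js X x = k *\<^sub>R X x"
    then obtain k where k: "Js X x = k *\<^sub>R X x" by blast
    have "g x (X x) (Js X x) = k * g x (X x) (X x)"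
      using g_linear[OF section_in_fibre[OF assms(1)]] section_in_fibre[OF assms(1)]
      unfolding k by (simp add: fibre_linear_def)
    then have "k = 0" using GX G_pos[OF assms] by (simp add: G_def)
    then have "Js (Js X) x = 0"
      using k J_linear section_in_fibre[OF assms(1), of x] unfolding Js_def fibre_linear_def
      by (metis scaleR_zero_left)
    then show False using assms by simp
  qed
  then have ind: "independent {X x, Js X x}"
    using assms(2) ne by (auto simp: insert_commute[of "X x"] independent_insert span_singleton)
  have J_comb: "J x (a *\<^sub>R X x + b *\<^sub>R Js X x) = a *\<^sub>R Js X x + (- b) *\<^sub>R X x" for a b
    using J_linear[of x] section_in_fibre[OF assms(1), of x] J_closed J_squared subspace_scale[OF subspace_fibre[of x]]
    by (simp add: fibre_linear_def Js_def)
  have "J x ` span {X x, Js X x} \<subseteq> span {X x, Js X x}"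
  proof
    fix e assume "e \<in> J x ` span {X x, Js X x}"
    then obtain a b where "e = J x (a *\<^sub>R X x + b *\<^sub>R Js X x)"
      by (auto simp: span_insert span_singleton algebra_simps)
    then have "e = a *\<^sub>R Js X x + (- b) *\<^sub>R X x"
      using J_comb by blast
    then show "e \<in> span {X x, Js X x}"
      by simp (intro span_diff span_scale span_base; simp)
  qed
  moreover have "dim (span {X x, Js X x}) = 2"
    using ind ne by (simp add: dim_eq_card_independent)
  moreover have "span {X x, Js X x} \<subseteq> E x"
    using section_in_fibre assms(1) by (intro span_minimal subspace_fibre) auto
  ultimately show "span {X x, Js X x} \<in> holomorphic_planes x"
    by (simp add: holomorphic_planes_def)
  show "sectional_curvature x (span {X x, Js X x}) = Q X (Js X) (Js X) X x / (G X X x)\<^sup>2"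
    using sectional_curvature_eq[of X "Js X" x] ne ind assms(1) GX by (simp add: power2_eq_square)
qed

end


section \<open>Curvature of a Kaehlerian Lie algebroid\<close>

text \<open>A Kaehlerian Lie algebroid with a Levi-Civita connection.\<close>

locale kaehlerian_levi_civita = hermitian_levi_civita charts E trivs rho br J g D
  + kaehlerian_lie_algebroid charts E trivs rho br J g
  for charts :: "('p::{t2_space,second_countable_topology} set \<times> ('p \<Rightarrow> 'b::real_inner)) set"
    and E :: "'p \<Rightarrow> 'v::real_vector set"
    and trivs :: "('p set \<times> ('p \<Rightarrow> 'f::euclidean_space \<Rightarrow> 'v)) set"
    and rho :: "'p \<Rightarrow> 'v \<Rightarrow> ('p \<Rightarrow> real) \<Rightarrow> real"
    and br :: "('p \<Rightarrow> 'v) \<Rightarrow> ('p \<Rightarrow> 'v) \<Rightarrow> ('p \<Rightarrow> 'v)"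
    and J :: "'p \<Rightarrow> 'v \<Rightarrow> 'v"
    and g :: "'p \<Rightarrow> 'v \<Rightarrow> 'v \<Rightarrow> real"
    and D :: "('p \<Rightarrow> 'v) \<Rightarrow> ('p \<Rightarrow> 'v) \<Rightarrow> ('p \<Rightarrow> 'v)"
begin

text \<open>Let \<open>A(X,Y,Z) = g((D\<^sub>X J)Y, Z)\<close>, which is skew in \<open>Y\<close> and \<open>Z\<close>. Closedness of the fundamental
  form says that the cyclic sum of \<open>A\<close> vanishes. Vanishing of the Nijenhuis tensor says that
  \<open>B(X,Y,Z) = A(JX,Y,Z) + A(X,Y,JZ)\<close> is symmetric in \<open>X\<close> and \<open>Y\<close>; being skew in \<open>Y\<close> and \<open>Z\<close> as well, it
  is zero. Then the cyclic sum for \<open>X\<close>, \<open>JY\<close>, \<open>JZ\<close> has the same terms as that for \<open>X\<close>, \<open>Y\<close>, \<open>Z\<close> except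
  for the sign of \<open>A(X,Y,Z)\<close>, and subtracting leaves \<open>A = 0\<close>.\<close>

lemma J_parallel:
  assumes "X \<in> \<Gamma>" "Y \<in> \<Gamma>"
  shows "D X (Js Y) = Js (D X Y)"
proof -
  define A where "A X Y Z = G (D X (Js Y) - Js (D X Y)) Z" for X Y Z
  have skew: "A X Y Z = - A X Z Y" if "X \<in> \<Gamma>" "Y \<in> \<Gamma>" "Z \<in> \<Gamma>" for X Y Z
  proof -
    have "act X (G (Js Y) Z) = - act X (G Y (Js Z))"
      using that by (simp add: G_Js_left act_minus)
    then have "G (D X (Js Y)) Z + G (Js Y) (D X Z) = - (G (D X Y) (Js Z) + G Y (D X (Js Z)))"
      using that by (simp add: D_metric)
    then show ?thesis
      using that G_sym[of Y "D X (Js Z)"] G_sym[of "Js (D X Z)" Y] G_Js_left[of Y "D X Z"]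
        G_Js_left[of "D X Y" Z] by (simp add: A_def G_diff_left algebra_simps)
  qed
  have AJ: "A X (Js Y) Z = A X Y (Js Z)" if "X \<in> \<Gamma>" "Y \<in> \<Gamma>" "Z \<in> \<Gamma>" for X Y Z
    using that by (simp add: A_def G_distribs D_distribs G_Js_left)
  have cyc: "A X Y Z + A Y Z X + A Z X Y = 0" if "X \<in> \<Gamma>" "Y \<in> \<Gamma>" "Z \<in> \<Gamma>" for X Y Z
  proof -
    have \<Phi>: "\<Phi> s t = G s (Js t)" for s t
      by (simp add: \<Phi>_def G_def Js_def fun_eq_iff)
    have "act X (G Y (Js Z)) - act Y (G X (Js Z)) + act Z (G X (Js Y))
        - G (br X Y) (Js Z) + G (br X Z) (Js Y) - G (br Y Z) (Js X) = 0"
      using \<Phi>_closed[OF that] by (simp add: d\<^sub>E_def \<Phi> act_def fun_eq_iff)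
    then have "A Y Z X = A Z Y X + A X Z Y"
      using that G_sym[of X "D Z (Js Y)"] G_sym[of Y "D X (Js Z)"] G_sym[of X "D Y (Js Z)"]
      by (simp add: A_def D_metric D_torsion G_distribs G_Js_left algebra_simps)
    then show ?thesis
      using skew[OF that] skew[OF that(3,1,2)] by simp
  qed
  have nij: "A (Js X) Y Z - A (Js Y) X Z + A X Y (Js Z) - A Y X (Js Z) = 0"
    if "X \<in> \<Gamma>" "Y \<in> \<Gamma>" "Z \<in> \<Gamma>" for X Y Z
  proof -
    have "br (Js X) (Js Y) - Js (br X (Js Y)) - Js (br (Js X) Y) - br X Y = 0"
      using J_integrable[OF that(1,2)] by (simp add: nijenhuis_def fun_eq_iff)
    then have "G (br (Js X) (Js Y) - Js (br X (Js Y)) - Js (br (Js X) Y) - br X Y) Z = 0"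
      using G_zero_left that by simp
    then show ?thesis
      using that by (simp add: A_def D_torsion D_distribs G_distribs Js_diff G_Js_left algebra_simps)
  qed
  have Jtype: "A (Js X) Y Z = - A X Y (Js Z)" if "X \<in> \<Gamma>" "Y \<in> \<Gamma>" "Z \<in> \<Gamma>" for X Y Z
  proof -
    define B where "B X Y Z x = A (Js X) Y Z x + A X Y (Js Z) x" for X Y Z x
    have Bs: "B X Y Z x = B Y X Z x" if "X \<in> \<Gamma>" "Y \<in> \<Gamma>" "Z \<in> \<Gamma>" for X Y Z x
      using fun_cong[OF nij[OF that], of x] by (simp add: B_def)
    have Bk: "B X Y Z x = - B X Z Y x" if "X \<in> \<Gamma>" "Y \<in> \<Gamma>" "Z \<in> \<Gamma>" for X Y Z x
      using that skew[of "Js X" Y Z] skew[of X Y "Js Z"] AJ[of X Z Y] by (simp add: B_def)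
    have "B X Y Z x = 0" for x
      using Bs[of X Y Z x] Bk[of Y X Z x] Bs[of Y Z X x] Bk[of Z Y X x] Bs[of Z X Y x] Bk[of X Z Y x] that
      by simp
    then show ?thesis by (simp add: B_def fun_eq_iff eq_neg_iff_add_eq_0)
  qed
  have "A X Y Z = 0" if "X \<in> \<Gamma>" "Y \<in> \<Gamma>" "Z \<in> \<Gamma>" for X Y Z
  proof
    fix x
    have m: "A X Y (- Z) x = - A X Y Z x" if "X \<in> \<Gamma>" "Y \<in> \<Gamma>" "Z \<in> \<Gamma>" for X Y Z
      using that by (simp add: A_def G_distribs)
    have "A (Js Y) (Js Z) X x = A Y Z X x"
      using Jtype[of Y "Js Z" X] AJ[of Y Z "Js X"] that m by simp
    moreover have "A (Js Z) X (Js Y) x = A Z X Y x"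
      using Jtype[of Z X "Js Y"] that m by simp
    moreover have "A X (Js Y) (Js Z) x = - A X Y Z x"
      using AJ[of X Y "Js Z"] that m by simp
    ultimately show "A X Y Z x = 0 x"
      using fun_cong[OF cyc[of X Y Z], of x] fun_cong[OF cyc[of X "Js Y" "Js Z"], of x] that by simp
  qed
  then have "D X (Js Y) - Js (D X Y) = 0"
    using assms by (intro G_nondegenerate) (auto simp: A_def)
  then show ?thesis by simp
qed

lemma Q_Js: 
  assumes "X \<in> \<Gamma>" "Y \<in> \<Gamma>" "Z \<in> \<Gamma>" "W \<in> \<Gamma>"
  shows "Q (Js X) (Js Y) Z W = Q X Y Z W"
proof -
  have "R Z W (Js X) = Js (R Z W X)"
    using assms by (simp add: R_br J_parallel Js_diff)
  then have "Q Z W (Js X) (Js Y) = Q Z W X Y"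
    using assms by (simp add: Q_def)
  then show ?thesis
    using assms Q_pair[of "Js X" "Js Y" Z W] Q_pair[of Z W X Y] by simp
qed

text \<open>The symmetries of the curvature tensor of a Kaehler structure at a point, for a form that
  is evaluated on global sections. Linearity in the last three arguments follows.\<close>

definition kaehler_form :: "(('p \<Rightarrow> 'v) \<Rightarrow> ('p \<Rightarrow> 'v) \<Rightarrow> ('p \<Rightarrow> 'v) \<Rightarrow> ('p \<Rightarrow> 'v) \<Rightarrow> real) \<Rightarrow> bool" where
  "kaehler_form T \<longleftrightarrow>
     (\<forall>X\<in>\<Gamma>. \<forall>X'\<in>\<Gamma>. \<forall>Y\<in>\<Gamma>. \<forall>Z\<in>\<Gamma>. \<forall>W\<in>\<Gamma>. T (X + X') Y Z W = T X Y Z W + T X' Y Z W) \<and>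
     (\<forall>c. \<forall>X\<in>\<Gamma>. \<forall>Y\<in>\<Gamma>. \<forall>Z\<in>\<Gamma>. \<forall>W\<in>\<Gamma>. T ((\<lambda>_. c) \<odot> X) Y Z W = c * T X Y Z W) \<and>
     (\<forall>X\<in>\<Gamma>. \<forall>Y\<in>\<Gamma>. \<forall>Z\<in>\<Gamma>. \<forall>W\<in>\<Gamma>. T X Y Z W = - T Y X Z W \<and> T X Y Z W = T Z W X Y \<and>
        T (Js X) (Js Y) Z W = T X Y Z W)"

lemma kaehler_formI:
  assumes "\<And>X X' Y Z W. X \<in> \<Gamma> \<Longrightarrow> X' \<in> \<Gamma> \<Longrightarrow> Y \<in> \<Gamma> \<Longrightarrow> Z \<in> \<Gamma> \<Longrightarrow> W \<in> \<Gamma> \<Longrightarrow>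
      T (X + X') Y Z W = T X Y Z W + T X' Y Z W"
    and "\<And>c X Y Z W. X \<in> \<Gamma> \<Longrightarrow> Y \<in> \<Gamma> \<Longrightarrow> Z \<in> \<Gamma> \<Longrightarrow> W \<in> \<Gamma> \<Longrightarrow> T ((\<lambda>_. c) \<odot> X) Y Z W = c * T X Y Z W"
    and "\<And>X Y Z W. X \<in> \<Gamma> \<Longrightarrow> Y \<in> \<Gamma> \<Longrightarrow> Z \<in> \<Gamma> \<Longrightarrow> W \<in> \<Gamma> \<Longrightarrow> T X Y Z W = - T Y X Z W"
    and "\<And>X Y Z W. X \<in> \<Gamma> \<Longrightarrow> Y \<in> \<Gamma> \<Longrightarrow> Z \<in> \<Gamma> \<Longrightarrow> W \<in> \<Gamma> \<Longrightarrow> T X Y Z W = T Z W X Y"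
    and "\<And>X Y Z W. X \<in> \<Gamma> \<Longrightarrow> Y \<in> \<Gamma> \<Longrightarrow> Z \<in> \<Gamma> \<Longrightarrow> W \<in> \<Gamma> \<Longrightarrow> T (Js X) (Js Y) Z W = T X Y Z W"
  shows "kaehler_form T"
  unfolding kaehler_form_def by (intro conjI ballI allI; fact assms)

lemma kaehler_formD:
  assumes "kaehler_form T" "X \<in> \<Gamma>" "Y \<in> \<Gamma>" "Z \<in> \<Gamma>" "W \<in> \<Gamma>"
  shows "T X Y Z W = - T Y X Z W" "T X Y Z W = - T X Y W Z" "T X Y Z W = T Z W X Y"
    "T (Js X) (Js Y) Z W = T X Y Z W" "T X Y (Js Z) (Js W) = T X Y Z W"
proof -
  have *: "T X Y Z W = - T Y X Z W \<and> T X Y Z W = T Z W X Y \<and> T (Js X) (Js Y) Z W = T X Y Z W"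
    if "X \<in> \<Gamma>" "Y \<in> \<Gamma>" "Z \<in> \<Gamma>" "W \<in> \<Gamma>" for X Y Z W
    using assms(1) that unfolding kaehler_form_def by blast
  show "T X Y Z W = - T Y X Z W" "T X Y Z W = T Z W X Y" "T (Js X) (Js Y) Z W = T X Y Z W"
    using *[OF assms(2-5)] by auto
  show "T X Y Z W = - T X Y W Z"
    using *[of X Y Z W] *[of Z W X Y] *[of X Y W Z] assms by simp
  show "T X Y (Js Z) (Js W) = T X Y Z W"
    using *[of X Y "Js Z" "Js W"] *[of Z W X Y] assms by simp
qed

text \<open>Affine dependence on each argument, with a constant factor \<open>t\<close>.\<close>

lemma kaehler_form_line:
  fixes t :: real
  assumes T: "kaehler_form T" and XX: "X \<in> \<Gamma>" "X' \<in> \<Gamma>" and Y: "Y \<in> \<Gamma>" "Z \<in> \<Gamma>" "W \<in> \<Gamma>"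
  defines "L \<equiv> X + (\<lambda>_. t) \<odot> X'"
  shows "T L Y Z W = T X Y Z W + t * T X' Y Z W" "T Y L Z W = T Y X Z W + t * T Y X' Z W"
    "T Y Z L W = T Y Z X W + t * T Y Z X' W" "T Y Z W L = T Y Z W X + t * T Y Z W X'"
proof -
  have L: "L \<in> \<Gamma>" using XX by (simp add: L_def)
  have *: "T L Y Z W = T X Y Z W + t * T X' Y Z W" if YZW: "Y \<in> \<Gamma>" "Z \<in> \<Gamma>" "W \<in> \<Gamma>" for Y Z W
  proof -
    have "(\<lambda>_. t) \<odot> X' \<in> \<Gamma>" using XX by simp
    then have "T L Y Z W = T X Y Z W + T ((\<lambda>_. t) \<odot> X') Y Z W"
      using T XX YZW unfolding kaehler_form_def L_def by blast
    moreover have "T ((\<lambda>_. t) \<odot> X') Y Z W = t * T X' Y Z W"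
      using T XX YZW unfolding kaehler_form_def by blast
    ultimately show ?thesis by simp
  qed
  note kD = kaehler_formD[OF T]
  show "T L Y Z W = T X Y Z W + t * T X' Y Z W"
    using * Y by blast
  show "T Y L Z W = T Y X Z W + t * T Y X' Z W"
    using *[of Y Z W] Y kD(1)[OF Y(1) _ Y(2,3), OF L] kD(1)[OF Y(1) _ Y(2,3), OF XX(1)]
      kD(1)[OF Y(1) _ Y(2,3), OF XX(2)] by simp
  show "T Y Z L W = T Y Z X W + t * T Y Z X' W"
    using *[of W Y Z] Y kD(3)[OF Y(1,2) L Y(3)] kD(3)[OF Y(1,2) XX(1) Y(3)] kD(3)[OF Y(1,2) XX(2) Y(3)] by simp
  show "T Y Z W L = T Y Z W X + t * T Y Z W X'"
    using *[of W Y Z] Y kD(3)[OF Y(1,2) L Y(3)] kD(3)[OF Y(1,2) XX(1) Y(3)] kD(3)[OF Y(1,2) XX(2) Y(3)]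
      kD(2)[OF Y L] kD(2)[OF Y XX(1)] kD(2)[OF Y XX(2)] by simp
qed

lemma kaehler_form_minus:
  assumes "kaehler_form T" "X \<in> \<Gamma>" "Y \<in> \<Gamma>" "Z \<in> \<Gamma>" "W \<in> \<Gamma>"
  shows "T (- X) Y Z W = - T X Y Z W" "T X (- Y) Z W = - T X Y Z W"
    "T X Y (- Z) W = - T X Y Z W" "T X Y Z (- W) = - T X Y Z W"
proof -
  have "S + (\<lambda>_. -2) \<odot> S = - S" for S
    by (simp add: scale_def fun_eq_iff scaleR_2)
  then show "T (- X) Y Z W = - T X Y Z W" "T X (- Y) Z W = - T X Y Z W"
    "T X Y (- Z) W = - T X Y Z W" "T X Y Z (- W) = - T X Y Z W"
    using kaehler_form_line[OF assms(1,2,2,3,4,5), of "-2"] kaehler_form_line[OF assms(1,3,3,2,4,5), of "-2"]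
      kaehler_form_line[OF assms(1,4,4,2,3,5), of "-2"] kaehler_form_line[OF assms(1,5,5,2,3,4), of "-2"]
    by simp_all
qed

text \<open>The values at \<open>1\<close>, \<open>-1\<close>, \<open>2\<close> and \<open>-2\<close> determine the linear coefficient.\<close>

lemma quartic_linear_coeff:
  fixes a0 a1 a2 a3 a4 b0 b1 b2 b3 b4 :: real
  assumes "\<And>t. a0 + a1 * t + a2 * t^2 + a3 * t^3 + a4 * t^4 = b0 + b1 * t + b2 * t^2 + b3 * t^3 + b4 * t^4"
  shows "a1 = b1"
  using assms[of 1] assms[of "-1"] assms[of 2] assms[of "-2"] by simp

text \<open>Substitute \<open>Y + t X\<close> for \<open>Y\<close> in the diagonal identity and compare the coefficients of \<open>t\<close>: this
  is the first claim. By the symmetries of \<open>T\<close> all four summands agree, which is the second.\<close>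

lemma kaehler_form_polarise:
  assumes T: "kaehler_form T" and XY: "X \<in> \<Gamma>" "Y \<in> \<Gamma>"
    and diag: "\<And>Y. Y \<in> \<Gamma> \<Longrightarrow> T Y (Js Y) (Js Y) Y = k * (G Y Y x)\<^sup>2"
  shows "T X (Js Y) (Js Y) Y + T Y (Js X) (Js Y) Y + T Y (Js Y) (Js X) Y + T Y (Js Y) (Js Y) X
      = 4 * k * G Y Y x * G Y X x" (is ?sum)
    and "T Y (Js Y) (Js Y) X = k * G Y Y x * G Y X x"
proof -
  define a0 where "a0 = T Y (Js Y) (Js Y) Y"
  define a1 where "a1 = T X (Js Y) (Js Y) Y + T Y (Js X) (Js Y) Y + T Y (Js Y) (Js X) Y + T Y (Js Y) (Js Y) X"
  define a2 where "a2 = T X (Js X) (Js Y) Y + T X (Js Y) (Js X) Y + T X (Js Y) (Js Y) X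
    + T Y (Js X) (Js X) Y + T Y (Js X) (Js Y) X + T Y (Js Y) (Js X) X"
  define a3 where "a3 = T Y (Js X) (Js X) X + T X (Js Y) (Js X) X + T X (Js X) (Js Y) X + T X (Js X) (Js X) Y"
  define a4 where "a4 = T X (Js X) (Js X) X"
  have "a1 = 4 * k * G Y Y x * G Y X x"
  proof (rule quartic_linear_coeff)
    fix t
    define L where "L = Y + (\<lambda>_. t) \<odot> X"
    have L: "L \<in> \<Gamma>" "Js L = Js Y + (\<lambda>_. t) \<odot> Js X"
      using XY by (simp_all add: L_def Js_add Js_scale)
    note lines = kaehler_form_line[OF T XY(2,1), of _ _ _ t, folded L_def]
      kaehler_form_line[OF T Js_closed[OF XY(2)] Js_closed[OF XY(1)], of _ _ _ t, folded L(2)]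
    have "T L (Js L) (Js L) L = a0 + a1 * t + a2 * t^2 + a3 * t^3 + a4 * t^4"
      using XY L(1) by (simp add: lines a0_def a1_def a2_def a3_def a4_def algebra_simps power_numeral_reduce)
    moreover have "G L L x = G Y Y x + 2 * t * G Y X x + t^2 * G X X x"
      using XY G_sym[of X Y] unfolding L_def
      by (simp add: G_add_left G_add_right G_scale_left G_scale_right algebra_simps power2_eq_square)
    moreover have "k * (G Y Y x + 2 * t * G Y X x + t^2 * G X X x)\<^sup>2 =
        k * (G Y Y x)\<^sup>2 + (4 * k * G Y Y x * G Y X x) * t
        + (4 * k * (G Y X x)\<^sup>2 + 2 * k * G Y Y x * G X X x) * t^2
        + (4 * k * G Y X x * G X X x) * t^3 + (k * (G X X x)\<^sup>2) * t^4"
      by (simp add: algebra_simps power_numeral_reduce)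
    ultimately show "a0 + a1 * t + a2 * t^2 + a3 * t^3 + a4 * t^4 =
        k * (G Y Y x)\<^sup>2 + (4 * k * G Y Y x * G Y X x) * t
        + (4 * k * (G Y X x)\<^sup>2 + 2 * k * G Y Y x * G X X x) * t^2
        + (4 * k * G Y X x * G X X x) * t^3 + (k * (G X X x)\<^sup>2) * t^4"
      using diag[OF L(1)] by simp
  qed
  then show ?sum by (simp add: a1_def)
  note minus = kaehler_form_minus[OF T]
  note kD = kaehler_formD[OF T]
  have "T X (Js Y) (Js Y) Y = T Y (Js Y) (Js Y) X"
    using XY kD(3)[of X "Js Y" "Js Y" Y] kD(1)[of "Js Y" Y X "Js Y"] kD(2)[of Y "Js Y" X "Js Y"] by simp
  moreover have "T Y (Js X) (Js Y) Y = T Y (Js Y) (Js Y) X"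
    using XY kD(4)[of Y "Js X" "Js Y" Y] minus kD(3)[of "Js Y" X "Js Y" Y] kD(1)[of "Js Y" Y "Js Y" X] by simp
  moreover have "T Y (Js Y) (Js X) Y = T Y (Js Y) (Js Y) X"
    using XY kD(5)[of Y "Js Y" "Js X" Y] minus kD(2)[of Y "Js Y" X "Js Y"] by simp
  ultimately show "T Y (Js Y) (Js Y) X = k * G Y Y x * G Y X x"
    using \<open>?sum\<close> by simp
qed

lemma Q_kaehler_form: "kaehler_form (\<lambda>X Y Z W. Q X Y Z W x)"
proof (rule kaehler_formI)
  fix X Y Z W assume XYZW: "X \<in> \<Gamma>" "Y \<in> \<Gamma>" "Z \<in> \<Gamma>" "W \<in> \<Gamma>"
  show "Q X Y Z W x = - Q Y X Z W x" "Q X Y Z W x = Q Z W X Y x" "Q (Js X) (Js Y) Z W x = Q X Y Z W x"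
    using fun_cong[OF Q_skew[OF XYZW], of x] fun_cong[OF Q_pair[OF XYZW], of x]
      fun_cong[OF Q_Js[OF XYZW], of x] by simp_all
qed (simp_all add: Q_add Q_scale)

section \<open>Schur's theorem\<close>

text \<open>The covariant derivative of the curvature form in the direction \<open>U\<close>.\<close>

definition DQ :: "('p \<Rightarrow> 'v) \<Rightarrow> ('p \<Rightarrow> 'v) \<Rightarrow> ('p \<Rightarrow> 'v) \<Rightarrow> ('p \<Rightarrow> 'v) \<Rightarrow> ('p \<Rightarrow> 'v) \<Rightarrow> 'p \<Rightarrow> real" where
  "DQ U X Y Z W = act U (Q X Y Z W)
    - Q (D U X) Y Z W - Q X (D U Y) Z W - Q X Y (D U Z) W - Q X Y Z (D U W)"

lemma DQ_kaehler_form: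
  assumes U: "U \<in> \<Gamma>"
  shows "kaehler_form (\<lambda>X Y Z W. DQ U X Y Z W x)"
proof -
  have sym: "DQ U X Y Z W = - DQ U Y X Z W" "DQ U X Y Z W = DQ U Z W X Y"
      "DQ U (Js X) (Js Y) Z W = DQ U X Y Z W"
    if [simp]: "X \<in> \<Gamma>" "Y \<in> \<Gamma>" "Z \<in> \<Gamma>" "W \<in> \<Gamma>" for X Y Z W
  proof -
    show "DQ U X Y Z W = - DQ U Y X Z W"
      using U Q_skew[of X Y Z W] Q_skew[of "D U X" Y Z W] Q_skew[of X "D U Y" Z W]
        Q_skew[of X Y "D U Z" W] Q_skew[of X Y Z "D U W"]
      by (simp add: DQ_def act_minus)
    show "DQ U X Y Z W = DQ U Z W X Y"
      using U Q_pair[of X Y Z W] Q_pair[of "D U X" Y Z W] Q_pair[of X "D U Y" Z W]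
        Q_pair[of X Y "D U Z" W] Q_pair[of X Y Z "D U W"]
      by (simp add: DQ_def)
    show "DQ U (Js X) (Js Y) Z W = DQ U X Y Z W"
      using U by (simp add: DQ_def J_parallel Q_Js)
  qed
  have add: "DQ U (X + X') Y Z W x = DQ U X Y Z W x + DQ U X' Y Z W x"
    if "X \<in> \<Gamma>" "X' \<in> \<Gamma>" "Y \<in> \<Gamma>" "Z \<in> \<Gamma>" "W \<in> \<Gamma>" for X X' Y Z W
    using that U by (simp add: DQ_def Q_add act_add D_add)
  have hom: "DQ U ((\<lambda>_. c) \<odot> X) Y Z W x = c * DQ U X Y Z W x"
    if "X \<in> \<Gamma>" "Y \<in> \<Gamma>" "Z \<in> \<Gamma>" "W \<in> \<Gamma>" for X Y Z W c
  proof -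
    have "0 \<odot> X = 0" by (simp add: scale_def fun_eq_iff)
    then have "D U ((\<lambda>_. c) \<odot> X) = (\<lambda>_. c) \<odot> D U X"
      using that U by (simp add: D_scale act_const)
    then show ?thesis
      using that U by (simp add: DQ_def Q_scale act_mult act_const algebra_simps)
  qed
  show ?thesis
  proof (rule kaehler_formI)
    fix X Y Z W assume XYZW: "X \<in> \<Gamma>" "Y \<in> \<Gamma>" "Z \<in> \<Gamma>" "W \<in> \<Gamma>"
    show "DQ U X Y Z W x = - DQ U Y X Z W x" "DQ U X Y Z W x = DQ U Z W X Y x"
      "DQ U (Js X) (Js Y) Z W x = DQ U X Y Z W x"
      using fun_cong[OF sym(1)[OF XYZW], of x] fun_cong[OF sym(2)[OF XYZW], of x]
        fun_cong[OF sym(3)[OF XYZW], of x] by simp_all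
  qed (use add hom in blast)+
qed

lemma DQ_bianchi:
  assumes "U \<in> \<Gamma>" "X \<in> \<Gamma>" "Y \<in> \<Gamma>" "Z \<in> \<Gamma>" "W \<in> \<Gamma>"
  shows "DQ U X Y Z W x + DQ X Y U Z W x + DQ Y U X Z W x = 0"
proof -
  have DQ_G: "DQ U X Y Z W = G (D U (R X Y Z) - R (D U X) Y Z - R X (D U Y) Z - R X Y (D U Z)) W"
    if "U \<in> \<Gamma>" "X \<in> \<Gamma>" "Y \<in> \<Gamma>" "Z \<in> \<Gamma>" "W \<in> \<Gamma>" for U X Y Z W
    using that by (simp add: DQ_def Q_def D_metric G_distribs)
  have "DQ U X Y Z W + DQ X Y U Z W + DQ Y U X Z W = G 0 W"
    unfolding bianchi_2[OF assms(1-4), symmetric] using assms by (simp add: DQ_G G_add_left)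
  then show ?thesis
    using G_zero_left[OF assms(5)] by (simp add: fun_eq_iff)
qed

text \<open>The second Bianchi identity for \<open>X\<close>, \<open>Y\<close>, \<open>JY\<close>, paired with \<open>JY\<close> and \<open>Y\<close>. By pair symmetry the
  terms differentiated along \<open>Y\<close> and \<open>JY\<close> are multiples of \<open>g(Y,X)\<close> and \<open>g(JY,X)\<close>.\<close>

lemma schur_orthogonal:
  assumes c: "c \<in> C_inf" and hol: "\<And>Y. Y \<in> \<Gamma> \<Longrightarrow> Q Y (Js Y) (Js Y) Y = c * (G Y Y * G Y Y)"
    and XY: "X \<in> \<Gamma>" "Y \<in> \<Gamma>" "Y x \<noteq> 0" "G Y X x = 0" "G (Js Y) X x = 0"
  shows "act X c x = 0"
proof -
  have diag: "DQ U Y (Js Y) (Js Y) Y x = act U c x * (G Y Y x)\<^sup>2" if U: "U \<in> \<Gamma>" and Y: "Y \<in> \<Gamma>" for U Y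
  proof -
    have "act U (Q Y (Js Y) (Js Y) Y) x
        = c x * (2 * G Y Y x * act U (G Y Y) x) + (G Y Y x)\<^sup>2 * act U c x"
      unfolding hol[OF Y] using U Y c by (simp add: act_mult power2_eq_square algebra_simps)
    moreover have "act U (G Y Y) x = 2 * G Y (D U Y) x"
      using U Y G_sym[of "D U Y" Y] by (simp add: D_metric)
    ultimately have "act U (Q Y (Js Y) (Js Y) Y) x = 4 * c x * G Y Y x * G Y (D U Y) x + act U c x * (G Y Y x)\<^sup>2"
      by simp
    moreover have "Q (D U Y) (Js Y) (Js Y) Y x + Q Y (Js (D U Y)) (Js Y) Y x
        + Q Y (Js Y) (Js (D U Y)) Y x + Q Y (Js Y) (Js Y) (D U Y) x = 4 * c x * G Y Y x * G Y (D U Y) x"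
      by (rule kaehler_form_polarise(1)[OF Q_kaehler_form]) (use U Y hol in \<open>auto simp: power2_eq_square\<close>)
    ultimately show ?thesis
      using U Y by (simp add: DQ_def J_parallel)
  qed
  have pol: "DQ U Z (Js Z) (Js Z) X x = act U c x * G Z Z x * G Z X x" if "U \<in> \<Gamma>" "Z \<in> \<Gamma>" for U Z
    by (rule kaehler_form_polarise(2)[OF DQ_kaehler_form]) (use that XY diag in auto)
  note kD = kaehler_formD[OF DQ_kaehler_form, of _ _ _ _ _ x]
  have 1: "DQ Y (Js Y) X (Js Y) Y x = 0"
    using pol[of Y Y] XY kD(3)[of Y "Js Y" X "Js Y" Y] kD(1)[of Y "Js Y" Y "Js Y" X] by simp
  have 2: "DQ (Js Y) X Y (Js Y) Y x = 0"
  proof -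
    note m = kaehler_form_minus[OF DQ_kaehler_form, of _ _ _ _ _ x]
    have "DQ (Js Y) Y (Js Y) Y X x = 0"
      using pol[of "Js Y" "Js Y"] XY kD(4)[of "Js Y" Y "Js Y" "- Y" X] m(3)[of "Js Y" Y "Js Y" Y X] by simp
    then show ?thesis
      using XY kD(3)[of "Js Y" X Y "Js Y" Y] kD(1)[of "Js Y" "Js Y" Y X Y] kD(2)[of "Js Y" Y "Js Y" X Y]
      by simp
  qed
  have "DQ X Y (Js Y) (Js Y) Y x = 0"
    using DQ_bianchi[of X Y "Js Y" "Js Y" Y x] 1 2 XY by simp
  then show ?thesis
    using diag[of X Y] XY G_pos[of Y x] by simp
qed

end


context hermitian_lie_algebroid
begin

text \<open>The two conditions on \<open>Y x\<close> are linear, so they have a common nonzero solution in rank at least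
  \<open>3\<close>. In a trivialisation, \<open>p w\<close> represents the functional \<open>g(w, \<sigma> \<sqdot>)\<close> by the inner product of the
  typical fibre.\<close>

lemma orthogonal_section:
  assumes "DIM('f) > 2" "u \<in> E x" "v \<in> E x"
  obtains Y where "Y \<in> \<Gamma>" "Y x \<noteq> 0" "g x (Y x) u = 0" "g x (Y x) v = 0"
proof -
  obtain U \<sigma> where c: "(U,\<sigma>) \<in> trivs" "x \<in> U" by (rule triv_at)
  define p where "p w = (\<Sum>b\<in>Basis. g x w (\<sigma> x b) *\<^sub>R b)" for w
  have p: "a \<bullet> p w = g x w (\<sigma> x a)" if "w \<in> E x" for a w
  proof -
    have "\<sigma> x a = (\<Sum>b\<in>Basis. (a \<bullet> b) *\<^sub>R \<sigma> x b)"
      using frame_expansion[OF c triv_linear(4)[OF c], of a] unfolding triv_linear(5)[OF c] .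
    then have "g x w (\<sigma> x a) = (\<Sum>b\<in>Basis. (a \<bullet> b) *\<^sub>R g x w (\<sigma> x b))"
      using fibre_linear_sum[OF g_linear[OF that], of Basis "\<sigma> x"] triv_linear(4)[OF c] by simp
    then show ?thesis
      by (simp add: p_def inner_sum_right mult.commute)
  qed
  have "dim {p u, p v} \<le> card {p u, p v}"
    by (intro dim_le_card) (auto intro: span_base)
  also have "\<dots> \<le> 2" by (simp add: card_insert_if)
  finally obtain a where a: "a \<noteq> 0" "\<And>y. y \<in> span {p u, p v} \<Longrightarrow> orthogonal a y"
    using orthogonal_to_subspace_exists[of "{p u, p v}"] assms(1) by auto
  obtain Y where Y: "Y \<in> \<Gamma>" "Y x = \<sigma> x a"
    using section_through[OF triv_linear(4)[OF c]] .
  have "\<sigma> x a \<noteq> 0"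
    using a(1) triv_linear(1,2)[OF c] linear_injective_0 by blast
  moreover have "g x (Y x) w = 0" if "w \<in> {u, v}" for w
    using that p[of w a] a(2)[OF span_base, of "p w"] assms Y g_sym[of "\<sigma> x a" x w] triv_linear(4)[OF c]
    by (auto simp: orthogonal_def)
  ultimately show thesis
    using that[OF Y(1)] Y(2) by simp
qed

end

context kaehlerian_levi_civita
begin

text \<open>Smoothness of \<open>c\<close> is part of the claim: tangent vectors vanish on functions that are not smooth
  by convention, so the second conclusion would be void without it. Locally \<open>c\<close> is the quotient
  of \<open>Q(Y,JY,JY,Y)\<close> and \<open>|Y|\<^sup>4\<close> for a section \<open>Y\<close> that does not vanish nearby.\<close>

lemma holomorphic_curvature_stationary:
  assumes dim: "DIM('f) > 2"
    and c: "\<And>x P. P \<in> holomorphic_planes x \<Longrightarrow> sectional_curvature x P = c x"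
  shows "c \<in> C_inf" "e \<in> E x \<Longrightarrow> rho x e c = 0"
proof -
  have hol: "Q Y (Js Y) (Js Y) Y y = c y * (G Y Y y * G Y Y y)" if Y: "Y \<in> \<Gamma>" for Y y
  proof (cases "Y y = 0")
    case True
    have "g y e 0 = 0" if "e \<in> E y" for e
      using g_linear[OF that] subspace_0[OF subspace_fibre[of y]] unfolding fibre_linear_def
      by (metis scaleR_zero_left)
    then have "G Z Y y = 0" if "Z \<in> \<Gamma>" for Z
      using section_in_fibre[OF that] True by (simp add: G_def)
    then show ?thesis
      using Y by (simp add: Q_def)
  next
    case False
    show ?thesis
      using c[OF holomorphic_plane_of_section(1)[OF Y False]] holomorphic_plane_of_section(2)[OF Y False]
        G_pos[OF Y False] by (simp add: power2_eq_square divide_eq_eq)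
  qed
  have "smooth_fun_on UNIV c"
  proof (rule smooth_fun_on_local)
    fix y
    obtain Y where Y: "Y \<in> \<Gamma>" "Y y \<noteq> 0"
      using orthogonal_section[OF dim, of 0 y 0] subspace_0[OF subspace_fibre] by blast
    define V where "V = {z. G Y Y z \<noteq> 0}"
    have V: "open V" "y \<in> V"
      using open_nonzero_set Y G_pos[OF Y] by (simp_all add: V_def)
    have "smooth_fun_on V (\<lambda>z. Q Y (Js Y) (Js Y) Y z * inverse (G Y Y z * G Y Y z))"
      using Y V(1) G_closed[OF Y(1) Y(1)] Q_closed[of Y "Js Y" "Js Y" Y]
      by (intro smooth_fun_on_mult smooth_fun_on_inverse)
        (auto simp: C_inf_def V_def times_fun_def intro: smooth_fun_on_subset)
    then have "smooth_fun_on V c"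
      by (rule smooth_fun_on_cong[OF V(1)]) (use hol[OF Y(1)] in \<open>simp add: V_def field_simps\<close>)
    then show "\<exists>V. open V \<and> y \<in> V \<and> smooth_fun_on (UNIV \<inter> V) c"
      using V by auto
  qed simp
  then show C: "c \<in> C_inf" by (simp add: C_inf_def)
  assume e: "e \<in> E x"
  obtain X where X: "X \<in> \<Gamma>" "X x = e"
    using section_through[OF e] .
  obtain Y where Y: "Y \<in> \<Gamma>" "Y x \<noteq> 0" "g x (Y x) (X x) = 0" "g x (Y x) (Js X x) = 0"
    using orthogonal_section[OF dim section_in_fibre[OF X(1)] section_in_fibre[OF Js_closed[OF X(1)]]] .
  have "act X c x = 0"
  proof (rule schur_orthogonal[OF C _ X(1) Y(1,2)])
    show "Q Y (Js Y) (Js Y) Y = c * (G Y Y * G Y Y)" if "Y \<in> \<Gamma>" for Y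
      using hol[OF that] by (simp add: fun_eq_iff)
    show "G Y X x = 0" "G (Js Y) X x = 0"
      using X Y by (simp_all add: G_Js_left) (simp_all add: G_def)
  qed
  then show "rho x e c = 0"
    using X(2) by (simp add: act_def)
qed

end

theorem theorem3p2:
  fixes charts :: "('p::{t2_space,second_countable_topology} set \<times> ('p \<Rightarrow> 'b::real_inner)) set"
    and E :: "'p \<Rightarrow> 'v::real_vector set"
    and trivs :: "('p set \<times> ('p \<Rightarrow> 'f::euclidean_space \<Rightarrow> 'v)) set"
    and rho :: "'p \<Rightarrow> 'v \<Rightarrow> ('p \<Rightarrow> real) \<Rightarrow> real"
    and br :: "('p \<Rightarrow> 'v) \<Rightarrow> ('p \<Rightarrow> 'v) \<Rightarrow> ('p \<Rightarrow> 'v)"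
    and J :: "'p \<Rightarrow> 'v \<Rightarrow> 'v"
    and g :: "'p \<Rightarrow> 'v \<Rightarrow> 'v \<Rightarrow> real"
    and m :: nat
  assumes "connected (UNIV :: 'p set)"
    and "transitive_lie_algebroid charts E trivs rho br"
    and "kaehlerian_lie_algebroid charts E trivs rho br J g"
    and "DIM('f) = 2 * m" and "2 * m \<ge> 4"
    and "hermitian_lie_algebroid.hol_curvature_pointwise_constant charts E trivs rho br J g"
  shows "hermitian_lie_algebroid.constant_hol_curvature charts E trivs rho br J g"
proof -
  interpret kaehlerian_lie_algebroid charts E trivs rho br J g by fact
  interpret transitive_lie_algebroid charts E trivs rho br by fact
  obtain c where c: "\<And>x P. P \<in> holomorphic_planes x \<Longrightarrow> sectional_curvature x P = c x"
    using assms(6) unfolding hol_curvature_pointwise_constant_def by metis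
  show ?thesis
  proof (cases "\<exists>D. levi_civita D")
    case True
    then obtain D where D: "levi_civita D" ..
    interpret kaehlerian_levi_civita charts E trivs rho br J g D
      by unfold_locales (fact D)
    have dim: "DIM('f) > 2" using assms(4,5) by simp
    note c' = holomorphic_curvature_stationary[OF dim c]
    have "v c = 0" if "v \<in> tangent_space x" for v x
      using that c'(2) anchor_surj[of x] by (metis imageE)
    then have "c x = c y" for x y
      using smooth_constant_if_derivations_vanish[OF assms(1) c'(1)] by blast
    then show ?thesis
      unfolding constant_hol_curvature_def using c by metis
  next
    case False
    \<comment> \<open>No number is described, so the description has one and the same default value throughout.\<close>
    then have "sectional_curvature x P = (THE k. False)" for x P
      by (simp add: sectional_curvature_def)
    then show ?thesis
      unfolding constant_hol_curvature_def by blast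
  qed
qed

end
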